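(* Let $X=\{x_1,\ldots,x_n\}$ be a finite metric space ($n\ge1$) whose zeta matrix $Z_X=(e^{-d_X(x_i,x_j)})_{i,j}$ is invertible, and fix a multiplicity vector $\bm s=(s_1,\ldots,s_n)\in\mathbb{Z}_{>0}^n$. Then the magnitude $Y\mapsto\mathrm{Mag}(Y)$ has stratified approximate limit $\mathrm{Mag}(X)$ at $X$ along $\bm s$. (That is, magnitude is approximately continuous at every finite metric space with invertible zeta matrix, on every fixed local cardinality/multiplicity stratum.)
   Context: For a finite metric space $X=\{x_1,\dots,x_n\}$, the distance matrix is $D_X=(d_X(x_i,x_j))_{i,j}$ and the zeta matrix is $Z_X=(e^{-d_X(x_i,x_j)})_{i,j}$. If $Z_X$ is invertible, the magnitude $\mathrm{Mag}(X)$ is the sum of all entries of $Z_X^{-1}$. For an $n\times n$ matrix $A=(a_{ij})$ and $\bm s\in\mathbb{Z}_{>0}^n$ with $N=\sum_i s_i$, $(A)_{\bm s}$ is the $N\times N$ block matrix whose $(i,j)$ block is the $s_i\times s_j$ matrix with all entries equal to $a_{ij}$. $\mathrm{Sym}_N^0$ is the space of real symmetric $N\times N$ matrices $(d_{ij})$ with zero diagonal, identified with $\mathbb{R}^{N(N-1)/2}$ via the entries $d_{ij}$ with $i<j$ and equipped with Lebesgue measure $\mathrm{vol}$ and Euclidean balls $B_r$ (for a zero-dimensional space, the measure is the unit point mass). $\mathcal{D}_N\subset\mathrm{Sym}_N^0$ is the set of distance matrices of ordered $N$-point metric spaces, i.e. matrices with $d_{ij}>0$ for $i\ne j$ and $d_{ik}\le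 d_{ij}+d_{jk}$ for all pairwise distinct $i,j,k$. Multiplicity stratum $\bm s$ near $X$: it consists of the $N$-point metric spaces $Y$ (where $N=\sum_i s_i$), sufficiently close to $X$ in the Gromov--Hausdorff metric, whose points split into clusters $Y_1,\dots,Y_n$ with $\#Y_i=s_i$, where $Y_i$ is the set of points of $Y$ close to $x_i$. The points of $Y$ are ordered blockwise (first the $s_1$ points of $Y_1$, then the $s_2$ points of $Y_2$, and so on). In these coordinates, the stratum near $X$ is described by the distance matrices $D_Y\in\mathcal{D}_N$ near $(D_X)_{\bm s}$. Stratified approximate limit: a function $F$, defined almost everywhere on this stratum with values in a metric space $(M,d_M)$, has stratified approximate limit $m\in M$ at $X$ along $\bm s$ if for every $\varepsilon>0$ the set $\{D_Y: d_M(F(Y),m)<\varepsilon\}$ has relative density one at $(D_X)_{\bm s}$ inside $\mathcal{D}_N$. Here a measurable subset $E\subset\mathcal{D}_N$ has relative density one at $P=(D_X)_{\bm s}$ inside $\mathcal{D}_N$ if $\mathrm{vol}(E\cap B_r(P))/\mathrm{vol}(\mathcal{D}_N\cap B_r(P))\to 1$ as $r\to 0^+$. *)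

theory Defs
  imports
    "HOL-Analysis.Analysis"
    "Jordan_Normal_Form.Gauss_Jordan_Elimination"
begin

definition distance_matrix :: "('a \<Rightarrow> 'a \<Rightarrow> real) \<Rightarrow> (nat \<Rightarrow> 'a) \<Rightarrow> nat \<Rightarrow> real mat" where
  "distance_matrix d x n = Matrix.mat n n (\<lambda>(i, j). d (x i) (x j))"

definition zeta_matrix :: "real mat \<Rightarrow> real mat" where
  "zeta_matrix D = map_mat (\<lambda>t. exp (- t)) D"

text \<open>Magnitude of a finite metric space as a function of its distance matrix; the value
  \<open>None\<close> means that the zeta matrix is not invertible.\<close>

definition magnitude :: "real mat \<Rightarrow> real option" where
  "magnitude D =
     map_option (\<lambda>W. \<Sum>i<dim_row W. \<Sum>j<dim_col W. W $$ (i, j)) (mat_inverse (zeta_matrix D))"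

lemma invertible_mat_iff_mat_inverse:
  fixes A :: "'a :: field mat"
  assumes A: "A \<in> carrier_mat n n"
  shows "invertible_mat A \<longleftrightarrow> mat_inverse A \<noteq> None"
proof
  assume "mat_inverse A \<noteq> None"
  then obtain B where "mat_inverse A = Some B" by auto
  from mat_inverse(2)[OF A this] A show "invertible_mat A"
    unfolding invertible_mat_def inverts_mat_def by auto
next
  assume "invertible_mat A"
  then obtain B where AB: "A * B = 1\<^sub>m n" and BA: "B * A = 1\<^sub>m (dim_row B)"
    using A unfolding invertible_mat_def inverts_mat_def by auto
  from arg_cong[OF AB, of dim_col] arg_cong[OF BA, of dim_col] A
  have B: "B \<in> carrier_mat n n" by auto
  with A AB BA have "A \<in> Units (ring_mat TYPE('a) n ())"
    by (auto simp: Units_def ring_mat_def)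
  with mat_inverse(1)[OF A, where b = "()"] show "mat_inverse A \<noteq> None" by blast
qed

lemma magnitude_defined_iff:
  assumes "D \<in> carrier_mat n n"
  shows "magnitude D \<noteq> None \<longleftrightarrow> invertible_mat (zeta_matrix D)"
  using invertible_mat_iff_mat_inverse[of "zeta_matrix D" n] assms
  by (auto simp: magnitude_def zeta_matrix_def)

text \<open>Blocks are numbered from \<open>0\<close>: block \<open>i\<close> consists of the \<open>s i\<close> indices \<open>p\<close> with
  \<open>s 0 + \<dots> + s (i - 1) \<le> p < s 0 + \<dots> + s i\<close>.\<close>

definition block_index :: "(nat \<Rightarrow> nat) \<Rightarrow> nat \<Rightarrow> nat" where
  "block_index s p = (LEAST i. p < (\<Sum>k\<le>i. s k))"

definition blow_up :: "real mat \<Rightarrow> (nat \<Rightarrow> nat) \<Rightarrow> real mat" where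
  "blow_up A s =
     (let N = \<Sum>i<dim_row A. s i
      in Matrix.mat N N (\<lambda>(p, q). A $$ (block_index s p, block_index s q)))"

definition Sym0 :: "nat \<Rightarrow> real mat set" where
  "Sym0 N = {D \<in> carrier_mat N N.
     (\<forall>i<N. D $$ (i, i) = 0) \<and> (\<forall>i<N. \<forall>j<N. D $$ (i, j) = D $$ (j, i))}"

definition upper_indices :: "nat \<Rightarrow> (nat \<times> nat) set" where
  "upper_indices N = {(i, j). i < j \<and> j < N}"

definition Sym0_coords :: "nat \<Rightarrow> real mat \<Rightarrow> (nat \<times> nat \<Rightarrow> real)" where
  "Sym0_coords N D = (\<lambda>(i, j)\<in>upper_indices N. D $$ (i, j))"

text \<open>Lebesgue measure is the completion of the product of one-dimensional Lebesgue measures.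
  For \<open>N \<le> 1\<close> the index set is empty, and the empty product is the unit point mass.\<close>

definition coords_lebesgue :: "nat \<Rightarrow> (nat \<times> nat \<Rightarrow> real) measure" where
  "coords_lebesgue N = completion (Pi\<^sub>M (upper_indices N) (\<lambda>_. lborel))"

definition Sym0_measurable :: "nat \<Rightarrow> real mat set \<Rightarrow> bool" where
  "Sym0_measurable N E \<longleftrightarrow> E \<subseteq> Sym0 N \<and> Sym0_coords N ` E \<in> sets (coords_lebesgue N)"

definition Sym0_null :: "nat \<Rightarrow> real mat set \<Rightarrow> bool" where
  "Sym0_null N E \<longleftrightarrow> E \<subseteq> Sym0 N \<and> Sym0_coords N ` E \<in> null_sets (coords_lebesgue N)"

definition Sym0_vol :: "nat \<Rightarrow> real mat set \<Rightarrow> real" where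
  "Sym0_vol N E = measure (coords_lebesgue N) (Sym0_coords N ` E)"

definition Sym0_ball :: "nat \<Rightarrow> real mat \<Rightarrow> real \<Rightarrow> real mat set" where
  "Sym0_ball N P r =
     {D \<in> Sym0 N. L2_set (\<lambda>e. D $$ e - P $$ e) (upper_indices N) < r}"

definition distance_matrices :: "nat \<Rightarrow> real mat set" where
  "distance_matrices N = {D \<in> Sym0 N.
     (\<forall>i<N. \<forall>j<N. i \<noteq> j \<longrightarrow> D $$ (i, j) > 0) \<and>
     (\<forall>i<N. \<forall>j<N. \<forall>k<N. i \<noteq> j \<and> j \<noteq> k \<and> i \<noteq> k \<longrightarrow> D $$ (i, k) \<le> D $$ (i, j) + D $$ (j, k))}"

definition relative_density_one :: "nat \<Rightarrow> real mat \<Rightarrow> real mat set \<Rightarrow> bool" where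
  "relative_density_one N P E \<longleftrightarrow>
     E \<subseteq> distance_matrices N \<and> Sym0_measurable N E \<and>
     ((\<lambda>r. Sym0_vol N (E \<inter> Sym0_ball N P r) /
            Sym0_vol N (distance_matrices N \<inter> Sym0_ball N P r)) \<longlongrightarrow> 1) (at_right 0)"

text \<open>\<open>F\<close> is a partial function of the blockwise ordered distance matrix of \<open>Y\<close>, and \<open>D\<^sub>X\<close> is
  the distance matrix of \<open>X\<close>. The stratum is a germ at \<open>blow_up D\<^sub>X s\<close>, so being defined almost
  everywhere on it means being defined almost everywhere on some neighbourhood of that point
  within the set of distance matrices.\<close>

definition stratified_approx_limit ::
  "(real mat \<Rightarrow> 'm :: metric_space option) \<Rightarrow> 'm \<Rightarrow> real mat \<Rightarrow> (nat \<Rightarrow> nat) \<Rightarrow> bool" where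
  "stratified_approx_limit F m D\<^sub>X s \<longleftrightarrow>
     (let N = \<Sum>i<dim_row D\<^sub>X. s i; P = blow_up D\<^sub>X s in
       (\<exists>r>0. Sym0_null N {D \<in> distance_matrices N \<inter> Sym0_ball N P r. F D = None}) \<and>
       (\<forall>\<epsilon>>0. relative_density_one N P
          {D \<in> distance_matrices N. \<exists>y. F D = Some y \<and> dist y m < \<epsilon>}))"

end

theory Submission
  imports Defs "Jordan_Normal_Form.Determinant"
begin

text \<open>Write \<open>D\<^sub>Y = (D\<^sub>X)\<^sub>s + r R\<close> with \<open>R\<close> in the unit ball. For a fixed \<open>R\<close>, choose a base point
  in every cluster, replace each other point by its difference with the base point (a unimodular
  congruence of \<open>Z\<^sub>Y\<close>), and divide the difference rows by \<open>r\<close>. As \<open>r \<rightarrow> 0\<close> the resulting matrix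
  converges to a block triangular one whose diagonal blocks are \<open>Z\<^sub>X\<close> and a matrix linear in \<open>R\<close>.
  Since \<open>Mag(Y) + 1 = det (Z\<^sub>Y + J) / det Z\<^sub>Y\<close> with the all-ones matrix \<open>J\<close>, which lives on the
  base block only, the second block cancels and \<open>Mag(Y) \<rightarrow> Mag(X)\<close>, as long as the second block is
  invertible. Its determinant is a polynomial in \<open>R\<close> that does not vanish identically, so this
  holds for almost every \<open>R\<close>, and dominated convergence on the unit ball shows that the bad set in
  the ball of radius \<open>r\<close> has volume \<open>o(r\<^sup>d)\<close>, where \<open>d = N (N - 1) / 2\<close>. Finally, raising all
  distances by amounts between \<open>r \<tau>\<close> and \<open>2 r \<tau>\<close> preserves the triangle inequality, so the
  distance matrices fill a fixed proportion of each small ball.\<close>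

subsection \<open>Determinants and magnitude\<close>

text \<open>Matrix determinant lemma. The bordered matrix with blocks \<open>A\<close>,
  \<open>U\<close>, \<open>- V\<close> and corner 1 is triangularised in two ways: eliminating with
  the corner leaves the Schur complement \<open>A + U * V\<close>, eliminating with \<open>A\<close>
  leaves the scalar \<open>1 + V * W * U\<close>.\<close>

lemma det_rank_one_update:
  fixes A W :: "'a :: idom mat"
  assumes A: "A \<in> carrier_mat n n" and W: "W \<in> carrier_mat n n" and AW: "A * W = 1\<^sub>m n"
  shows "Determinant.det (Matrix.mat n n (\<lambda>(i, j). A $$ (i, j) + u i * v j)) =
    Determinant.det A * (1 + (\<Sum>i<n. \<Sum>j<n. v i * W $$ (i, j) * u j))"
proof -
  define U where "U = Matrix.mat n 1 (\<lambda>(i, j). u i)"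
  define V where "V = Matrix.mat 1 n (\<lambda>(i, j). v j)"
  define C where "C = Matrix.mat n n (\<lambda>(i, j). A $$ (i, j) + u i * v j)"
  have [simp]: "U \<in> carrier_mat n 1" "V \<in> carrier_mat 1 n" "C \<in> carrier_mat n n"
    "U \<in> carrier_mat n (Suc 0)" "V \<in> carrier_mat (Suc 0) n"
    by (auto simp: U_def V_def C_def)
  have [simp]: "dim_row U = n" "dim_col U = Suc 0" "dim_row V = Suc 0" "dim_col V = n"
    "dim_row C = n" "dim_col C = n"
    by (auto simp: U_def V_def C_def)
  note [simp] = A W carrier_matD[OF A] carrier_matD[OF W]
  have lower: "Determinant.det (four_block_mat X Y (0\<^sub>m 1 n) (1\<^sub>m 1)) = Determinant.det X"
    if "X \<in> carrier_mat n n" "Y \<in> carrier_mat n 1" for X Y :: "'a mat"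
    using det_four_block_mat_lower_left_zero[of X n Y 1 "0\<^sub>m 1 n" "1\<^sub>m 1"] that by simp
  have upper: "Determinant.det (four_block_mat X (0\<^sub>m n 1) (- V) Y) = Determinant.det X * Determinant.det Y"
    if "X \<in> carrier_mat n n" "Y \<in> carrier_mat 1 1" for X Y :: "'a mat"
    using det_four_block_mat_upper_right_zero[of X n "0\<^sub>m n 1" 1 "- V" Y] that by simp
  have C: "C + U * (- V) = A"
    by (rule eq_matI) (auto simp: C_def U_def V_def scalar_prod_def)
  have AWU: "A * (- (W * U)) + U * 1\<^sub>m 1 = 0\<^sub>m n 1"
  proof -
    have "A * (W * U) = A * W * U" by (rule assoc_mult_mat[symmetric, of _ n n _ n _ 1]) simp_all
    also have "\<dots> = U" unfolding AW by (rule left_mult_one_mat[of _ _ 1]) simp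
    finally have "A * (- (W * U)) = - U" by simp
    then show ?thesis by (simp add: uminus_l_inv_mat[of _ n "Suc 0"])
  qed
  have "Determinant.det (four_block_mat C U (0\<^sub>m 1 n) (1\<^sub>m 1)) *
      Determinant.det (four_block_mat (1\<^sub>m n) (0\<^sub>m n 1) (- V) (1\<^sub>m 1)) =
    Determinant.det (four_block_mat C U (0\<^sub>m 1 n) (1\<^sub>m 1) *
      four_block_mat (1\<^sub>m n) (0\<^sub>m n 1) (- V) (1\<^sub>m 1))"
    by (rule det_mult[symmetric, of _ "n + 1"]) (rule four_block_carrier_mat; simp)+
  also have "four_block_mat C U (0\<^sub>m 1 n) (1\<^sub>m 1) * four_block_mat (1\<^sub>m n) (0\<^sub>m n 1) (- V) (1\<^sub>m 1)
     = four_block_mat A U (- V) (1\<^sub>m 1)"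
    by (subst mult_four_block_mat[of _ n n _ 1 _ 1 _ _ n _ 1]) (use C in auto)
  finally have 1: "Determinant.det C = Determinant.det (four_block_mat A U (- V) (1\<^sub>m 1))"
    using lower[of C U] upper[of "1\<^sub>m n" "1\<^sub>m 1"] by simp
  have "Determinant.det (four_block_mat A U (- V) (1\<^sub>m 1)) *
      Determinant.det (four_block_mat (1\<^sub>m n) (- (W * U)) (0\<^sub>m 1 n) (1\<^sub>m 1)) =
    Determinant.det (four_block_mat A U (- V) (1\<^sub>m 1) *
      four_block_mat (1\<^sub>m n) (- (W * U)) (0\<^sub>m 1 n) (1\<^sub>m 1))"
    by (rule det_mult[symmetric, of _ "n + 1"]) (rule four_block_carrier_mat; simp)+
  also have "four_block_mat A U (- V) (1\<^sub>m 1) *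
      four_block_mat (1\<^sub>m n) (- (W * U)) (0\<^sub>m 1 n) (1\<^sub>m 1)
     = four_block_mat A (0\<^sub>m n 1) (- V) (- V * (- (W * U)) + 1\<^sub>m 1)"
    by (subst mult_four_block_mat[of _ n n _ 1 _ 1 _ _ n _ 1]) (use AWU in auto)
  finally have 2: "Determinant.det (four_block_mat A U (- V) (1\<^sub>m 1)) =
      Determinant.det A * Determinant.det (- V * (- (W * U)) + 1\<^sub>m 1)"
    using lower[of "1\<^sub>m n" "- (W * U)"] upper[of A "- V * (- (W * U)) + 1\<^sub>m 1"]
      mult_carrier_mat[of W n n U 1] by simp
  have "Determinant.det (- V * (- (W * U)) + 1\<^sub>m 1) = 1 + (V * (W * U)) $$ (0, 0)"
    by (subst det_single) auto
  also have "(V * (W * U)) $$ (0, 0) = (\<Sum>i<n. \<Sum>j<n. v i * W $$ (i, j) * u j)"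
    using W by (simp add: U_def V_def scalar_prod_def sum_distrib_left atLeast0LessThan mult.assoc)
  finally show ?thesis using 1 2 by (simp add: C_def)
qed

text \<open>The determinant is a polynomial in \<open>u\<close> whose value at 0 is that of
  \<open>B\<close>, so it is not the zero polynomial.\<close>

lemma finite_det_zeros:
  fixes A B :: "real mat"
  assumes A: "A \<in> carrier_mat n n" and B: "B \<in> carrier_mat n n" and "Determinant.det B \<noteq> 0"
  shows "finite {u. Determinant.det (Matrix.mat n n (\<lambda>(i, j). B $$ (i, j) + u * A $$ (i, j))) = 0}"
proof -
  define Q where "Q = Matrix.mat n n (\<lambda>(i, j). [: B $$ (i, j), A $$ (i, j) :])"
  have eval: "poly (Determinant.det Q) u =
    Determinant.det (Matrix.mat n n (\<lambda>(i, j). B $$ (i, j) + u * A $$ (i, j)))" for u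
  proof -
    \<comment> \<open>Evaluation at \<open>u\<close> is a ring homomorphism and hence commutes with
      determinants.\<close>
    interpret comm_ring_hom "\<lambda>p :: real poly. poly p u"
      by unfold_locales auto
    have "poly (Determinant.det Q) u = Determinant.det (map_mat (\<lambda>p. poly p u) Q)"
      by simp
    also have "map_mat (\<lambda>p. poly p u) Q = Matrix.mat n n (\<lambda>(i, j). B $$ (i, j) + u * A $$ (i, j))"
      by (rule eq_matI) (auto simp: Q_def)
    finally show ?thesis .
  qed
  have "Matrix.mat n n (\<lambda>(i, j). B $$ (i, j) + 0 * A $$ (i, j)) = B"
    by (rule eq_matI) (use B in auto)
  with eval[of 0] assms have "Determinant.det Q \<noteq> 0" by force
  then have "finite {u. poly (Determinant.det Q) u = 0}" by (rule poly_roots_finite)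
  then show ?thesis by (simp add: eval)
qed

text \<open>Reversal of the polynomial: for \<open>t \<noteq> 0\<close>, division by
  \<open>t\<close> turns \<open>A + t * B\<close> into \<open>B + u * A\<close> with
  \<open>u = inverse t\<close>, so the leading coefficient takes the role of the constant
  term.\<close>

lemma finite_det_zeros_lead:
  fixes A B :: "real mat"
  assumes A: "A \<in> carrier_mat n n" and B: "B \<in> carrier_mat n n" and "Determinant.det B \<noteq> 0"
  shows "finite {t. Determinant.det (Matrix.mat n n (\<lambda>(i, j). A $$ (i, j) + t * B $$ (i, j))) = 0}"
    (is "finite {t. Determinant.det (?C t) = 0}")
proof -
  let ?D = "\<lambda>u. Matrix.mat n n (\<lambda>(i, j). B $$ (i, j) + u * A $$ (i, j))"
  have "Determinant.det (?D (inverse t)) = 0" if "t \<noteq> 0" "Determinant.det (?C t) = 0" for t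
  proof -
    have "?D (inverse t) = inverse t \<cdot>\<^sub>m ?C t"
      by (rule eq_matI) (use \<open>t \<noteq> 0\<close> in \<open>auto simp: field_simps\<close>)
    with that show ?thesis by simp
  qed
  then have "{t. Determinant.det (?C t) = 0} \<subseteq> insert 0 (inverse ` {u. Determinant.det (?D u) = 0})"
    by (force intro: rev_image_eqI)
  then show ?thesis
    by (rule finite_subset) (use finite_det_zeros[OF assms] in simp)
qed

lemma det_scale_rows:
  fixes f :: "nat \<Rightarrow> nat \<Rightarrow> 'a :: comm_ring_1"
  shows "Determinant.det (Matrix.mat n n (\<lambda>(i, j). c i * f i j)) =
    (\<Prod>i<n. c i) * Determinant.det (Matrix.mat n n (\<lambda>(i, j). f i j))"
proof -
  have "Matrix.mat n n (\<lambda>(i, j). c i * f i j) =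
      mat\<^sub>r n n (\<lambda>i. c i \<cdot>\<^sub>v Matrix.vec n (f i))"
    and "Matrix.mat n n (\<lambda>(i, j). f i j) = mat\<^sub>r n n (\<lambda>i. Matrix.vec n (f i))"
    by (auto intro!: eq_matI)
  then show ?thesis by (simp add: det_rows_mul atLeast0LessThan)
qed

lemma tendsto_det:
  assumes "\<And>i j. i < n \<Longrightarrow> j < n \<Longrightarrow> ((\<lambda>r. f r i j :: real) \<longlongrightarrow> g i j) F"
  shows "((\<lambda>r. Determinant.det (Matrix.mat n n (\<lambda>(i, j). f r i j))) \<longlongrightarrow>
    Determinant.det (Matrix.mat n n (\<lambda>(i, j). g i j))) F"
  unfolding det_def'[OF mat_carrier]
proof (intro tendsto_sum tendsto_mult tendsto_const tendsto_prod)
  fix p i assume "p \<in> {p. p permutes {0..<n}}" "i \<in> {0..<n}"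
  then have "i < n" "p i < n" by (auto simp: permutes_in_image)
  with assms show "((\<lambda>r. Matrix.mat n n (\<lambda>(i, j). f r i j) $$ (i, p i)) \<longlongrightarrow>
      Matrix.mat n n (\<lambda>(i, j). g i j) $$ (i, p i)) F" by simp
qed

lemma borel_measurable_det:
  assumes "\<And>i j. i < n \<Longrightarrow> j < n \<Longrightarrow> (\<lambda>x. f x i j :: real) \<in> borel_measurable M"
  shows "(\<lambda>x. Determinant.det (Matrix.mat n n (\<lambda>(i, j). f x i j))) \<in> borel_measurable M"
  unfolding det_def'[OF mat_carrier]
proof (intro borel_measurable_sum borel_measurable_times borel_measurable_const borel_measurable_prod)
  fix p i assume "p \<in> {p. p permutes {0..<n}}" "i \<in> {0..<n}"
  then have "i < n" "p i < n" by (auto simp: permutes_in_image)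
  with assms show "(\<lambda>x. Matrix.mat n n (\<lambda>(i, j). f x i j) $$ (i, p i)) \<in> borel_measurable M"
    by simp
qed

section \<open>Magnitude as a ratio of determinants\<close>

lemma mat_inverse_eq_None_iff_det:
  fixes A :: "'a :: field mat"
  assumes A: "A \<in> carrier_mat n n"
  shows "mat_inverse A = None \<longleftrightarrow> Determinant.det A = 0"
proof
  assume "mat_inverse A = None"
  from mat_inverse(1)[OF A this, where b = "()"] det_non_zero_imp_unit[OF A, where b = "()"]
  show "Determinant.det A = 0" by auto
next
  assume 0: "Determinant.det A = 0"
  show "mat_inverse A = None"
  proof (rule ccontr)
    assume "mat_inverse A \<noteq> None"
    then obtain W where "mat_inverse A = Some W" by auto
    from mat_inverse(2)[OF A this] have "A * W = 1\<^sub>m n" "W \<in> carrier_mat n n" by auto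
    with det_mult[OF A, of W] 0 show False by simp
  qed
qed

lemma zeta_matrix_carrier: "D \<in> carrier_mat n n \<Longrightarrow> zeta_matrix D \<in> carrier_mat n n"
  by (simp add: zeta_matrix_def)

lemma magnitude_eq_None_iff:
  "D \<in> carrier_mat n n \<Longrightarrow> magnitude D = None \<longleftrightarrow> Determinant.det (zeta_matrix D) = 0"
  by (simp add: magnitude_def mat_inverse_eq_None_iff_det[OF zeta_matrix_carrier])

text \<open>Rank-one update by the all-ones matrix. The ratio is unchanged when both determinants
  are multiplied by the same factor, so its limit can be found even where the zeta matrix itself
  becomes singular.\<close>

lemma magnitude_eq_det_ratio:
  assumes D: "D \<in> carrier_mat n n" and nz: "Determinant.det (zeta_matrix D) \<noteq> 0"
  shows "magnitude D = Some (Determinant.det (Matrix.mat n n (\<lambda>(i, j). exp (- D $$ (i, j)) + 1)) /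
    Determinant.det (Matrix.mat n n (\<lambda>(i, j). exp (- D $$ (i, j)))) - 1)"
proof -
  note Z = zeta_matrix_carrier[OF D]
  obtain W where W: "mat_inverse (zeta_matrix D) = Some W"
    using nz mat_inverse_eq_None_iff_det[OF Z] by auto
  from mat_inverse(2)[OF Z W] have AW: "zeta_matrix D * W = 1\<^sub>m n" and Wc: "W \<in> carrier_mat n n"
    by auto
  have "Matrix.mat n n (\<lambda>(i, j). exp (- D $$ (i, j))) = zeta_matrix D"
    by (rule eq_matI) (use D in \<open>auto simp: zeta_matrix_def\<close>)
  moreover have "Matrix.mat n n (\<lambda>(i, j). exp (- D $$ (i, j)) + 1) =
      Matrix.mat n n (\<lambda>(i, j). zeta_matrix D $$ (i, j) + 1 * 1)"
    by (rule eq_matI) (use D in \<open>auto simp: zeta_matrix_def\<close>)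
  ultimately show ?thesis
    using det_rank_one_update[OF Z Wc AW, of "\<lambda>_. 1" "\<lambda>_. 1"] nz W Wc
    by (simp add: magnitude_def)
qed

subsection \<open>Lebesgue measure on finite products\<close>

lemma lborel_affine_preimage:
  fixes A :: "real set"
  assumes "A \<in> sets borel" "c > 0"
  shows "emeasure lborel A = ennreal c * emeasure lborel {x. p + c * x \<in> A}"
proof -
  have "emeasure lborel A = emeasure (density (distr lborel borel (\<lambda>x. p + c * x)) (\<lambda>_. ennreal \<bar>c\<bar>)) A"
    using assms by (subst lborel_real_affine[of c p]) auto
  also have "\<dots> = ennreal c * emeasure (distr lborel borel (\<lambda>x. p + c * x)) A"
    using assms by (simp add: emeasure_density nn_integral_cmult_indicator)
  also have "emeasure (distr lborel borel (\<lambda>x. p + c * x)) A = emeasure lborel {x. p + c * x \<in> A}"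
    using assms by (simp add: emeasure_distr vimage_def)
  finally show ?thesis .
qed

interpretation lborel_product: product_sigma_finite "\<lambda>_ :: 'i. lborel :: real measure"
  by unfold_locales

abbreviation lborel_PiM :: "'i set \<Rightarrow> ('i \<Rightarrow> real) measure" where
  "lborel_PiM I \<equiv> Pi\<^sub>M I (\<lambda>_. lborel)"

text \<open>A product measure is determined by its values on boxes, and on a box the affine change
  of variables contributes one factor \<open>c\<close> per coordinate.\<close>

lemma lborel_PiM_affine_preimage:
  fixes I :: "'i set"
  assumes I: "finite I" and c: "c > 0" and A: "A \<in> sets (lborel_PiM I)"
  shows "emeasure (lborel_PiM I) A =
    ennreal (c ^ card I) * emeasure (lborel_PiM I) {y \<in> space (lborel_PiM I). (\<lambda>e\<in>I. p e + c * y e) \<in> A}"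
proof -
  let ?f = "\<lambda>y. \<lambda>e\<in>I. p e + c * y e"
  have f [measurable]: "?f \<in> measurable (lborel_PiM I) (lborel_PiM I)"
    by measurable
  let ?P = "scale_measure (ennreal (c ^ card I)) (distr (lborel_PiM I) (lborel_PiM I) ?f)"
  have "?P = lborel_PiM I"
  proof (rule lborel_product.PiM_eqI[OF I])
    fix B :: "'i \<Rightarrow> real set" assume B: "\<And>i. i \<in> I \<Longrightarrow> B i \<in> sets lborel"
    have "?f -` Pi\<^sub>E I B \<inter> space (lborel_PiM I) = Pi\<^sub>E I (\<lambda>e. {x. p e + c * x \<in> B e})"
      by (auto simp: space_PiM PiE_iff)
    moreover have "emeasure (lborel_PiM I) (Pi\<^sub>E I (\<lambda>e. {x. p e + c * x \<in> B e})) =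
        (\<Prod>e\<in>I. emeasure lborel {x. p e + c * x \<in> B e})"
    proof (rule lborel_product.emeasure_PiM[OF I])
      fix e assume "e \<in> I"
      with B have [measurable]: "B e \<in> sets borel" by simp
      show "{x. p e + c * x \<in> B e} \<in> sets lborel" by measurable
    qed
    moreover have "Pi\<^sub>E I B \<in> sets (lborel_PiM I)"
      using B I by (intro sets_PiM_I_finite) auto
    ultimately have "emeasure ?P (Pi\<^sub>E I B) =
        ennreal (c ^ card I) * (\<Prod>e\<in>I. emeasure lborel {x. p e + c * x \<in> B e})"
      by (simp add: emeasure_distr)
    also have "\<dots> = (\<Prod>e\<in>I. ennreal c * emeasure lborel {x. p e + c * x \<in> B e})"
      using c by (simp add: prod.distrib ennreal_power)
    also have "\<dots> = (\<Prod>e\<in>I. emeasure lborel (B e))"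
    proof (rule prod.cong)
      fix e assume "e \<in> I"
      then show "ennreal c * emeasure lborel {x. p e + c * x \<in> B e} = emeasure lborel (B e)"
        using lborel_affine_preimage[of "B e" c "p e"] B c by simp
    qed simp
    finally show "emeasure ?P (Pi\<^sub>E I B) = (\<Prod>e\<in>I. emeasure lborel (B e))" .
  qed simp
  then have "emeasure (lborel_PiM I) A = emeasure ?P A" by simp
  also have "\<dots> = ennreal (c ^ card I) *
      emeasure (lborel_PiM I) {y \<in> space (lborel_PiM I). ?f y \<in> A}"
    using A by (simp add: emeasure_distr vimage_def Int_def conj_commute)
  finally show ?thesis .
qed

text \<open>Fubini for the pairs \<open>(t, y)\<close> with \<open>y + t v \<in> G\<close> and \<open>0 \<le> t \<le> 1\<close>: sections in \<open>t\<close> are null, and sections in \<open>y\<close>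
  are translates of \<open>G\<close>.\<close>

lemma null_sets_lborel_PiM_if_countable_on_lines:
  fixes I :: "'i set"
  assumes I: "finite I" and G: "G \<in> sets (lborel_PiM I)"
    and lines: "\<And>y. y \<in> space (lborel_PiM I) \<Longrightarrow> countable {t. (\<lambda>e\<in>I. y e + t * v e) \<in> G}"
  shows "G \<in> null_sets (lborel_PiM I)"
proof -
  interpret I: finite_product_sigma_finite "\<lambda>_. lborel" I
    by unfold_locales (rule I)
  interpret pair_sigma_finite lborel "lborel_PiM I"
    by unfold_locales
  let ?N = "lborel_PiM I"
  define H where "H = {z \<in> space (lborel \<Otimes>\<^sub>M ?N). fst z \<in> {0..1} \<and> (\<lambda>e\<in>I. snd z e + fst z * v e) \<in> G}"
  have H: "H \<in> sets (lborel \<Otimes>\<^sub>M ?N)"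
    unfolding H_def using G by measurable
  have "emeasure (lborel \<Otimes>\<^sub>M ?N) H = (\<integral>\<^sup>+y. emeasure lborel ((\<lambda>t. (t, y)) -` H) \<partial>?N)"
    by (rule emeasure_pair_measure_alt2[OF H])
  also have "\<dots> = (\<integral>\<^sup>+y. 0 \<partial>?N)"
  proof (rule nn_integral_cong)
    fix y assume "y \<in> space ?N"
    then have "countable ((\<lambda>t. (t, y)) -` H)"
      by (intro countable_subset[OF _ lines[of y]]) (auto simp: H_def)
    then show "emeasure lborel ((\<lambda>t. (t, y)) -` H) = 0"
      by (rule emeasure_lborel_countable)
  qed
  finally have "0 = emeasure (lborel \<Otimes>\<^sub>M ?N) H" by simp
  also have "\<dots> = (\<integral>\<^sup>+t. emeasure ?N (Pair t -` H) \<partial>lborel)"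
    by (rule I.emeasure_pair_measure_alt[OF H])
  also have "\<dots> = (\<integral>\<^sup>+t. emeasure ?N G * indicator {0..1} t \<partial>(lborel :: real measure))"
  proof (rule nn_integral_cong)
    fix t :: real
    have "emeasure ?N {y \<in> space ?N. (\<lambda>e\<in>I. t * v e + 1 * y e) \<in> G} = emeasure ?N G"
      using lborel_PiM_affine_preimage[OF I _ G, of 1 "\<lambda>e. t * v e"] by simp
    moreover have "Pair t -` H = (if t \<in> {0..1} then {y \<in> space ?N. (\<lambda>e\<in>I. t * v e + 1 * y e) \<in> G} else {})"
      by (auto simp: H_def space_pair_measure add.commute)
    ultimately show "emeasure ?N (Pair t -` H) = emeasure ?N G * indicator {0..1} t"
      by simp
  qed
  also have "\<dots> = emeasure ?N G"
    by (simp add: nn_integral_cmult_indicator)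
  finally show ?thesis using G by (simp add: null_sets_def)
qed

subsection \<open>Zeta matrices near a blow-up\<close>

text \<open>\<open>c\<close> sends each of the \<open>N\<close> points of \<open>Y\<close> to the
  index of the point of \<open>X\<close> that it is close to; surjectivity says that no cluster is
  empty.\<close>

locale clustering =
  fixes N n :: nat and c :: "nat \<Rightarrow> nat"
  assumes cluster_less: "p < N \<Longrightarrow> c p < n"
    and cluster_surj: "i < n \<Longrightarrow> \<exists>p<N. c p = i"
begin

text \<open>Taking the least member of the cluster gives \<open>base p \<le> p\<close>, which makes
  the differencing matrix triangular.\<close>

definition base :: "nat \<Rightarrow> nat" where
  "base p = (LEAST q. c q = c p)"

definition nonbase :: "nat \<Rightarrow> bool" where
  "nonbase p \<longleftrightarrow> base p \<noteq> p"

lemma base_le: "base p \<le> p"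
  unfolding base_def by (rule Least_le) simp

lemma cluster_base [simp]: "c (base p) = c p"
  unfolding base_def by (rule LeastI[of "\<lambda>q. c q = c p" p]) simp

lemma base_eq_iff: "base p = base q \<longleftrightarrow> c p = c q"
  by (metis base_def cluster_base)

lemma base_base [simp]: "base (base p) = base p"
  by (simp add: base_eq_iff)

lemma not_nonbase_base [simp]: "\<not> nonbase (base p)"
  by (simp add: nonbase_def)

lemma base_less: "p < N \<Longrightarrow> base p < N"
  using base_le[of p] by simp

lemma base_eq_self: "\<not> nonbase p \<Longrightarrow> base p = p"
  by (simp add: nonbase_def)

text \<open>Base points represent every cluster exactly once. The weights \<open>of_bool\<close> are
  those of the rank-one update on the base block.\<close>

lemma sum_over_bases: "(\<Sum>p<N. of_bool (\<not> nonbase p) * f (c p)) = (\<Sum>i<n. f i :: real)"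
proof -
  have "bij_betw c {p \<in> {..<N}. \<not> nonbase p} {..<n}"
    unfolding bij_betw_def
  proof (intro conjI equalityI subsetI)
    show "inj_on c {p \<in> {..<N}. \<not> nonbase p}"
      by (rule inj_onI) (metis (mono_tags) base_eq_iff base_eq_self mem_Collect_eq)
    fix i assume "i \<in> {..<n}"
    then obtain p where "p < N" "c p = i" using cluster_surj by auto
    then show "i \<in> c ` {p \<in> {..<N}. \<not> nonbase p}"
      by (intro image_eqI[of _ _ "base p"]) (auto simp: base_less)
  qed (auto simp: cluster_less)
  then have "(\<Sum>p\<in>{p \<in> {..<N}. \<not> nonbase p}. f (c p)) = (\<Sum>i<n. f i)"
    by (rule sum.reindex_bij_betw)
  moreover have "(\<Sum>p<N. of_bool (\<not> nonbase p) * f (c p)) = (\<Sum>p\<in>{p \<in> {..<N}. \<not> nonbase p}. f (c p))"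
    by (rule sum.mono_neutral_cong_right) auto
  ultimately show ?thesis by simp
qed

section \<open>Differencing against base points\<close>

definition col_diff :: "(nat \<Rightarrow> nat \<Rightarrow> real) \<Rightarrow> nat \<Rightarrow> nat \<Rightarrow> real" where
  "col_diff f p q = f p q - of_bool (nonbase q) * f p (base q)"

text \<open>Entries of the congruent matrix \<open>transpose B * F * B\<close>, where
  \<open>F\<close> has the entries \<open>f\<close> and \<open>B\<close> is the unipotent matrix in
  the proof of \<open>det_col_diff\<close>.\<close>

definition diff :: "(nat \<Rightarrow> nat \<Rightarrow> real) \<Rightarrow> nat \<Rightarrow> nat \<Rightarrow> real" where
  "diff f p q = col_diff f p q - of_bool (nonbase p) * col_diff f (base p) q"

text \<open>Column differencing is right multiplication by \<open>B\<close>, which is upper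
  triangular because \<open>base q \<le> q\<close> and has unit diagonal because a non-base point
  differs from its base point.\<close>

lemma det_col_diff:
  "Determinant.det (Matrix.mat N N (\<lambda>(p, q). col_diff f p q)) = Determinant.det (Matrix.mat N N (\<lambda>(p, q). f p q))"
proof -
  define B where "B = Matrix.mat N N (\<lambda>(p, q). of_bool (p = q) - of_bool (nonbase q \<and> p = base q) :: real)"
  have [simp]: "B \<in> carrier_mat N N" by (simp add: B_def)
  have "Determinant.det B = prod_list (diag_mat B)"
  proof (rule det_upper_triangular[of _ N])
    show "upper_triangular B"
    proof (rule upper_triangularI)
      fix p q assume "q < p" "p < dim_row B"
      with base_le[of q] show "B $$ (p, q) = 0" by (auto simp: B_def)
    qed
  qed simp
  also have "\<dots> = 1"
    unfolding prod_list_diag_prod by (rule prod.neutral) (auto simp: B_def nonbase_def)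
  finally have B: "Determinant.det B = 1" .
  have "Matrix.mat N N (\<lambda>(p, q). col_diff f p q) = Matrix.mat N N (\<lambda>(p, q). f p q) * B"
  proof (rule eq_matI)
    fix p q assume "p < dim_row (Matrix.mat N N (\<lambda>(p, q). f p q) * B)"
      "q < dim_col (Matrix.mat N N (\<lambda>(p, q). f p q) * B)"
    then have *: "p < N" "q < N" by (auto simp: B_def)
    then have "(Matrix.mat N N (\<lambda>(p, q). f p q) * B) $$ (p, q) =
        (\<Sum>k\<in>{0..<N}. f p k * (of_bool (k = q) - of_bool (nonbase q \<and> k = base q)))"
      by (simp add: B_def scalar_prod_def)
    also have "\<dots> = (\<Sum>k\<in>{0..<N}. (if k = q then f p k else 0) -
        (if k = base q then of_bool (nonbase q) * f p k else 0))"
      by (rule sum.cong) auto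
    also have "\<dots> = col_diff f p q"
      using * base_less by (simp add: sum_subtractf col_diff_def)
    finally show "Matrix.mat N N (\<lambda>(p, q). col_diff f p q) $$ (p, q) =
        (Matrix.mat N N (\<lambda>(p, q). f p q) * B) $$ (p, q)"
      using * by simp
  qed (auto simp: B_def)
  then show ?thesis using B by (simp add: det_mult[of _ N])
qed

text \<open>Transposition turns row differences into column differences, so the column version
  applies twice.\<close>

lemma det_diff:
  "Determinant.det (Matrix.mat N N (\<lambda>(p, q). diff f p q)) = Determinant.det (Matrix.mat N N (\<lambda>(p, q). f p q))"
proof -
  have swap: "Determinant.det (Matrix.mat N N (\<lambda>(p, q). g q p)) = Determinant.det (Matrix.mat N N (\<lambda>(p, q). g p q))"
    for g :: "nat \<Rightarrow> nat \<Rightarrow> real"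
    by (subst det_transpose[of _ N, symmetric]) (auto intro!: arg_cong[of _ _ Determinant.det])
  have "Determinant.det (Matrix.mat N N (\<lambda>(p, q). diff f p q)) =
      Determinant.det (Matrix.mat N N (\<lambda>(p, q). col_diff (\<lambda>q p. col_diff f p q) q p))"
    by (simp add: diff_def col_diff_def[of "\<lambda>q p. col_diff f p q"])
  also have "\<dots> = Determinant.det (Matrix.mat N N (\<lambda>(p, q). col_diff (\<lambda>q p. col_diff f p q) p q))"
    by (rule swap)
  also have "\<dots> = Determinant.det (Matrix.mat N N (\<lambda>(p, q). col_diff f q p))"
    by (rule det_col_diff)
  also have "\<dots> = Determinant.det (Matrix.mat N N (\<lambda>(p, q). col_diff f p q))"
    by (rule swap)
  also have "\<dots> = Determinant.det (Matrix.mat N N (\<lambda>(p, q). f p q))"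
    by (rule det_col_diff)
  finally show ?thesis .
qed

text \<open>Up to the order of the indices, the block diagonal matrix with \<open>f\<close> on the
  base points and the identity on the non-base points; no permutation of the points is
  required.\<close>

definition base_extension :: "(nat \<Rightarrow> nat \<Rightarrow> real) \<Rightarrow> real mat" where
  "base_extension f = Matrix.mat N N (\<lambda>(p, q). if nonbase p \<or> nonbase q then of_bool (p = q) else f (c p) (c q))"

lemma base_extension_carrier [simp]: "base_extension f \<in> carrier_mat N N"
  by (simp add: base_extension_def)

text \<open>Block diagonal matrices multiply block by block; on the base block the sum over points
  collapses to a sum over clusters.\<close>

lemma base_extension_mult:
  assumes "\<And>i j. i < n \<Longrightarrow> j < n \<Longrightarrow> (\<Sum>k<n. f i k * g k j) = h i j"
  shows "base_extension f * base_extension g = base_extension h"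
proof (rule eq_matI)
  fix p q assume "p < dim_row (base_extension h)" "q < dim_col (base_extension h)"
  then have *: "p < N" "q < N" by (auto simp: base_extension_def)
  let ?F = "\<lambda>f p q. if nonbase p \<or> nonbase q then of_bool (p = q) else f (c p) (c q)"
  have "(base_extension f * base_extension g) $$ (p, q) = (\<Sum>k<N. ?F f p k * ?F g k q)"
    using * by (simp add: base_extension_def scalar_prod_def atLeast0LessThan)
  also have "\<dots> = ?F h p q"
  proof (cases "nonbase p \<or> nonbase q")
    case True
    then have "(\<Sum>k<N. ?F f p k * ?F g k q) = (\<Sum>k<N. if k = p then of_bool (p = q) else 0)"
      by (intro sum.cong) (auto split: if_splits)
    with * True show ?thesis by simp
  next
    case False
    then have "(\<Sum>k<N. ?F f p k * ?F g k q) = (\<Sum>k<N. of_bool (\<not> nonbase k) * (f (c p) (c k) * g (c k) (c q)))"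
      by (intro sum.cong) auto
    also have "\<dots> = (\<Sum>k<n. f (c p) k * g k (c q))"
      by (rule sum_over_bases)
    finally show ?thesis using False * assms cluster_less by simp
  qed
  finally show "(base_extension f * base_extension g) $$ (p, q) = base_extension h $$ (p, q)"
    using * by (simp add: base_extension_def)
qed (auto simp: base_extension_def)

lemma base_extension_one: "base_extension (\<lambda>i j. of_bool (i = j)) = 1\<^sub>m N"
  by (rule eq_matI) (auto simp: base_extension_def base_eq_iff[symmetric] base_eq_self)

text \<open>Factorisation of a block triangular matrix: the left factor carries the base block, the
  right factor the non-base rows. It separates the contribution of \<open>X\<close> from that of the
  perturbation.\<close>

lemma base_extension_mult_rows:
  "base_extension f * Matrix.mat N N (\<lambda>(p, q). if nonbase p then g p q else of_bool (p = q)) =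
   Matrix.mat N N (\<lambda>(p, q). if nonbase p then g p q else if nonbase q then 0 else f (c p) (c q))"
    (is "_ * ?M = ?L")
proof (rule eq_matI)
  fix p q assume "p < dim_row ?L" "q < dim_col ?L"
  then have *: "p < N" "q < N" by auto
  have "(base_extension f * ?M) $$ (p, q) = (\<Sum>k<N. (if nonbase p \<or> nonbase k then of_bool (p = k) else f (c p) (c k)) *
      (if nonbase k then g k q else of_bool (k = q)))"
    using * by (simp add: base_extension_def scalar_prod_def atLeast0LessThan)
  also have "\<dots> = ?L $$ (p, q)"
  proof (cases "nonbase p")
    case True
    then have "(\<Sum>k<N. (if nonbase p \<or> nonbase k then of_bool (p = k) else f (c p) (c k)) *
        (if nonbase k then g k q else of_bool (k = q))) = (\<Sum>k<N. if k = p then g p q else 0)"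
      by (intro sum.cong) auto
    with * True show ?thesis by simp
  next
    case False
    then have "(\<Sum>k<N. (if nonbase p \<or> nonbase k then of_bool (p = k) else f (c p) (c k)) *
        (if nonbase k then g k q else of_bool (k = q))) =
        (\<Sum>k<N. if k = q then (if nonbase q then 0 else f (c p) (c q)) else 0)"
      by (intro sum.cong) auto
    with * False show ?thesis by simp
  qed
  finally show "(base_extension f * ?M) $$ (p, q) = ?L $$ (p, q)" .
qed (auto simp: base_extension_def)

end

section \<open>First-order term of the zeta matrix at a blow-up\<close>

locale clustered_zeta = clustering +
  fixes \<delta> :: "nat \<Rightarrow> nat \<Rightarrow> real" and W :: "real mat"
  assumes dist_zero: "i < n \<Longrightarrow> \<delta> i i = 0"
    and W: "W \<in> carrier_mat n n"
    and zeta_W: "Matrix.mat n n (\<lambda>(i, j). exp (- \<delta> i j)) * W = 1\<^sub>m n"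
begin

text \<open>Derivative at \<open>r = 0\<close> of the differenced zeta matrix; only its rows at non-base points are relevant,
  because there the zeroth-order term cancels.\<close>

definition first_order :: "(nat \<Rightarrow> nat \<Rightarrow> real) \<Rightarrow> nat \<Rightarrow> nat \<Rightarrow> real" where
  "first_order R p q = - diff (\<lambda>p q. exp (- \<delta> (c p) (c q)) * R p q) p q"

definition first_order_mat :: "(nat \<Rightarrow> nat \<Rightarrow> real) \<Rightarrow> real mat" where
  "first_order_mat R = Matrix.mat N N (\<lambda>(p, q). if nonbase p then first_order R p q else of_bool (p = q))"

text \<open>The tree metric in which every non-base point has distance \<open>1/2\<close> to its base point: in this direction
  the first-order matrix is unipotent lower triangular.\<close>

definition star :: "nat \<Rightarrow> nat \<Rightarrow> real" where
  "star p q = (if p \<noteq> q \<and> c p = c q then (of_bool (nonbase p) + of_bool (nonbase q)) / 2 else 0)"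

lemma first_order_mat_cong:
  assumes "\<And>p q. p < N \<Longrightarrow> q < N \<Longrightarrow> R p q = R' p q"
  shows "first_order_mat R = first_order_mat R'"
proof -
  have "first_order R p q = first_order R' p q" if "p < N" "q < N" for p q
    by (simp only: first_order_def diff_def col_diff_def assms that base_less)
  then show ?thesis by (auto simp: first_order_mat_def intro!: eq_matI)
qed

lemma first_order_add: "first_order (\<lambda>p q. R p q + t * V p q) p q = first_order R p q + t * first_order V p q"
  by (simp add: first_order_def diff_def col_diff_def algebra_simps)

text \<open>Inside a cluster the exponential factor is 1, and across clusters \<open>star\<close> is
  0. With base point \<open>b\<close>, the difference \<open>star p q - star p b - star b q\<close>
  is 1 - 1/2 - 1/2 = 0 for distinct non-base points of the cluster and -1 for
  \<open>p = q\<close>.\<close>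

lemma first_order_star:
  assumes "p < N" "q < N" "nonbase p"
  shows "first_order star p q = of_bool (p = q) - of_bool (q = base p) / 2"
proof -
  have eq: "exp (- \<delta> (c p) (c q)) * star p q = star p q" if "p < N" for p q
    using dist_zero[OF cluster_less[OF that]] by (auto simp: star_def)
  have "first_order star p q = - diff star p q"
    unfolding first_order_def diff_def col_diff_def eq[OF assms(1)] eq[OF base_less[OF assms(1)]]
    by (rule refl)
  moreover have "diff star p q = of_bool (q = base p) / 2 - of_bool (p = q)"
  proof (cases "c q = c p")
    case True
    then have b: "base q = base p" by (simp add: base_eq_iff)
    have np: "p \<noteq> base p" "base p \<noteq> p" using \<open>nonbase p\<close> by (auto simp: nonbase_def)
    show ?thesis
    proof (cases "nonbase q")
      case nq: True
      then have "q \<noteq> base p" "base p \<noteq> q" by auto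
      with np True nq \<open>nonbase p\<close> b show ?thesis
        by (simp add: diff_def col_diff_def star_def)
    next
      case False
      with b have "q = base p" using base_eq_self[of q] by simp
      with np \<open>nonbase p\<close> show ?thesis
        by (simp add: diff_def col_diff_def star_def)
    qed
  next
    case False
    then show ?thesis by (auto simp: diff_def col_diff_def star_def)
  qed
  ultimately show ?thesis by simp
qed

text \<open>In the pencil \<open>A + t * B\<close> the matrix \<open>B\<close> is lower triangular
  with unit diagonal, so the determinant has degree \<open>N\<close> in \<open>t\<close> and
  finitely many zeros.\<close>

lemma finite_singular_on_star_lines:
  "finite {t. Determinant.det (first_order_mat (\<lambda>p q. R p q + t * star p q)) = 0}"
proof -
  define A where "A = Matrix.mat N N (\<lambda>(p, q). if nonbase p then first_order R p q else 0)"
  define B where "B = Matrix.mat N N (\<lambda>(p, q). if nonbase p then first_order star p q else of_bool (p = q))"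
  have AB: "A \<in> carrier_mat N N" "B \<in> carrier_mat N N" by (auto simp: A_def B_def)
  have "Determinant.det B = prod_list (diag_mat B)"
  proof (rule det_lower_triangular)
    fix p q assume "p < q" "q < N"
    with base_le[of p] show "B $$ (p, q) = 0"
      by (auto simp: B_def first_order_star)
  qed (rule AB)
  also have "\<dots> = 1"
    unfolding prod_list_diag_prod
    by (rule prod.neutral) (auto simp: B_def first_order_star nonbase_def)
  finally have "Determinant.det B \<noteq> 0" by simp
  note fin = finite_det_zeros_lead[OF AB this]
  \<comment> \<open>The base rows of \<open>first_order_mat\<close> are constant in
    \<open>t\<close>, those of the pencil are \<open>t\<close> times unit rows. The two determinants
    therefore differ by a power of \<open>t\<close>, and every zero of the first is a zero of the
    second.\<close>
  have "Matrix.mat N N (\<lambda>(p, q). A $$ (p, q) + t * B $$ (p, q)) =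
      Matrix.mat N N (\<lambda>(p, q). (if nonbase p then 1 else t) *
        (if nonbase p then first_order (\<lambda>p q. R p q + t * star p q) p q else of_bool (p = q)))" for t
    by (rule eq_matI) (auto simp: A_def B_def first_order_add)
  then have "Determinant.det (Matrix.mat N N (\<lambda>(p, q). A $$ (p, q) + t * B $$ (p, q))) =
      (\<Prod>p<N. if nonbase p then 1 else t) * Determinant.det (first_order_mat (\<lambda>p q. R p q + t * star p q))" for t
    by (simp only: det_scale_rows first_order_mat_def)
  then show ?thesis
    by (intro finite_subset[OF _ fin]) auto
qed

section \<open>Limit of the rescaled zeta matrix and of the determinant ratio\<close>

definition perturbed_zeta :: "(nat \<Rightarrow> nat \<Rightarrow> real) \<Rightarrow> real \<Rightarrow> nat \<Rightarrow> nat \<Rightarrow> real" where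
  "perturbed_zeta R r p q = exp (- (\<delta> (c p) (c q) + r * R p q))"

definition scaled_diff :: "(nat \<Rightarrow> nat \<Rightarrow> real) \<Rightarrow> real \<Rightarrow> nat \<Rightarrow> nat \<Rightarrow> real" where
  "scaled_diff R r p q = (if nonbase p then inverse r else 1) * diff (perturbed_zeta R r) p q"

text \<open>In a base row the entries at non-base columns are differences that tend to 0, and no
  division by \<open>r\<close> compensates this; hence the zero block.\<close>

definition limit_mat :: "(nat \<Rightarrow> nat \<Rightarrow> real) \<Rightarrow> nat \<Rightarrow> nat \<Rightarrow> real" where
  "limit_mat R p q = (if nonbase p then first_order R p q
     else if nonbase q then 0 else exp (- \<delta> (c p) (c q)))"

text \<open>The unperturbed matrix is constant on clusters, so a row equals the row of its base
  point.\<close>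

lemma diff_exp_cluster:
  "nonbase p \<Longrightarrow> diff (\<lambda>p q. exp (- \<delta> (c p) (c q))) p q = 0"
  by (simp add: diff_def col_diff_def)

lemma tendsto_exp_difference_quotient:
  "((\<lambda>r. inverse r * (exp (- (r * x)) - 1)) \<longlongrightarrow> - x) (at_right (0 :: real))"
proof -
  have "((\<lambda>r. exp (- (r * x))) has_real_derivative - x) (at 0)"
    by (auto intro!: derivative_eq_intros)
  then have "((\<lambda>r. (exp (- (r * x)) - 1) / r) \<longlongrightarrow> - x) (at 0)"
    by (simp add: DERIV_def)
  then show ?thesis
    by (simp add: filterlim_at_split divide_inverse mult.commute)
qed

lemma tendsto_scaled_diff:
  "((\<lambda>r. scaled_diff R r p q) \<longlongrightarrow> limit_mat R p q) (at_right 0)"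
proof (cases "nonbase p")
  case True
  have pz: "perturbed_zeta R r p q = exp (- \<delta> (c p) (c q)) * exp (- (r * R p q))" for r p q
    by (simp add: perturbed_zeta_def flip: exp_add)
  \<comment> \<open>Subtracting the vanishing zeroth-order term turns the division by
    \<open>r\<close> into a difference quotient in every entry.\<close>
  have eq: "scaled_diff R r p q = diff (\<lambda>p q. exp (- \<delta> (c p) (c q)) * (inverse r * (exp (- (r * R p q)) - 1))) p q" for r
  proof -
    have "scaled_diff R r p q = inverse r * (diff (perturbed_zeta R r) p q - diff (\<lambda>p q. exp (- \<delta> (c p) (c q))) p q)"
      using True by (simp add: scaled_diff_def diff_exp_cluster)
    also have "\<dots> = diff (\<lambda>p q. exp (- \<delta> (c p) (c q)) * (inverse r * (exp (- (r * R p q)) - 1))) p q"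
      by (simp add: diff_def col_diff_def pz algebra_simps)
    finally show ?thesis .
  qed
  have "((\<lambda>r. diff (\<lambda>p q. exp (- \<delta> (c p) (c q)) * (inverse r * (exp (- (r * R p q)) - 1))) p q) \<longlongrightarrow>
      diff (\<lambda>p q. exp (- \<delta> (c p) (c q)) * (- R p q)) p q) (at_right 0)"
    unfolding diff_def col_diff_def
    by (intro tendsto_intros tendsto_exp_difference_quotient)
  also have "diff (\<lambda>p q. exp (- \<delta> (c p) (c q)) * (- R p q)) p q = limit_mat R p q"
    using True by (simp add: limit_mat_def first_order_def diff_def col_diff_def)
  finally show ?thesis by (simp add: eq)
next
  case False
  have z: "((\<lambda>r. perturbed_zeta R r p q) \<longlongrightarrow> exp (- \<delta> (c p) (c q))) (at_right 0)" for p q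
    unfolding perturbed_zeta_def by (auto intro!: tendsto_eq_intros)
  have "((\<lambda>r. diff (perturbed_zeta R r) p q) \<longlongrightarrow> diff (\<lambda>p q. exp (- \<delta> (c p) (c q))) p q) (at_right 0)"
    unfolding diff_def col_diff_def by (intro tendsto_intros z)
  with False show ?thesis
    by (cases "nonbase q") (simp_all add: scaled_diff_def limit_mat_def diff_def col_diff_def)
qed

text \<open>The limit factors into the base extension of the zeta matrix of \<open>X\<close> and
  \<open>first_order_mat R\<close>. Adding ones on the base block is a rank-one update of the first
  factor only, and the inverse of that factor is the base extension of \<open>W\<close>.\<close>

lemma det_limit_mat:
  shows "Determinant.det (Matrix.mat N N (\<lambda>(p, q). limit_mat R p q)) \<noteq> 0 \<longleftrightarrow>
      Determinant.det (first_order_mat R) \<noteq> 0" (is ?nonzero)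
    and "Determinant.det (Matrix.mat N N (\<lambda>(p, q). limit_mat R p q + of_bool (\<not> nonbase p) * of_bool (\<not> nonbase q))) =
      Determinant.det (Matrix.mat N N (\<lambda>(p, q). limit_mat R p q)) * (1 + (\<Sum>i<n. \<Sum>j<n. W $$ (i, j)))" (is ?ratio)
proof -
  let ?z = "\<lambda>i j. exp (- \<delta> i j)"
  let ?w = "\<lambda>i j. W $$ (i, j)"
  let ?M = "first_order_mat R"
  have "(\<Sum>k<n. ?z i k * ?w k j) = of_bool (i = j)" if "i < n" "j < n" for i j
  proof -
    have "(\<Sum>k<n. ?z i k * ?w k j) = (Matrix.mat n n (\<lambda>(i, j). exp (- \<delta> i j)) * W) $$ (i, j)"
      using that W by (simp add: scalar_prod_def atLeast0LessThan)
    with that show ?thesis by (simp add: zeta_W)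
  qed
  then have inv: "base_extension ?z * base_extension ?w = 1\<^sub>m N"
    by (simp add: base_extension_mult base_extension_one)
  have M [simp]: "?M \<in> carrier_mat N N" by (simp add: first_order_mat_def)
  have L: "Matrix.mat N N (\<lambda>(p, q). limit_mat R p q) = base_extension ?z * ?M"
    unfolding first_order_mat_def base_extension_mult_rows limit_mat_def ..
  have L': "Matrix.mat N N (\<lambda>(p, q). limit_mat R p q + of_bool (\<not> nonbase p) * of_bool (\<not> nonbase q)) =
      base_extension (\<lambda>i j. ?z i j + 1) * ?M"
    unfolding first_order_mat_def base_extension_mult_rows limit_mat_def by (rule eq_matI) auto
  have "Determinant.det (base_extension ?z) * Determinant.det (base_extension ?w) = 1"
    using arg_cong[OF inv, of Determinant.det] by (simp add: det_mult[of _ N])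
  then have nz: "Determinant.det (base_extension ?z) \<noteq> 0" by auto
  have "base_extension (\<lambda>i j. ?z i j + 1) = Matrix.mat N N (\<lambda>(p, q). base_extension ?z $$ (p, q) +
      of_bool (\<not> nonbase p) * of_bool (\<not> nonbase q))"
    by (rule eq_matI) (auto simp: base_extension_def)
  then have "Determinant.det (base_extension (\<lambda>i j. ?z i j + 1)) = Determinant.det (base_extension ?z) *
      (1 + (\<Sum>p<N. \<Sum>q<N. of_bool (\<not> nonbase p) * base_extension ?w $$ (p, q) * of_bool (\<not> nonbase q)))"
    using det_rank_one_update[OF _ _ inv, of "\<lambda>p. of_bool (\<not> nonbase p)" "\<lambda>p. of_bool (\<not> nonbase p)"] by simp
  also have "(\<Sum>p<N. \<Sum>q<N. of_bool (\<not> nonbase p) * base_extension ?w $$ (p, q) * of_bool (\<not> nonbase q)) =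
      (\<Sum>p<N. of_bool (\<not> nonbase p) * (\<Sum>q<N. of_bool (\<not> nonbase q) * ?w (c p) (c q)))"
    unfolding sum_distrib_left by (intro sum.cong) (auto simp: base_extension_def)
  also have "\<dots> = (\<Sum>i<n. \<Sum>j<n. ?w i j)"
  proof -
    have "(\<Sum>q<N. of_bool (\<not> nonbase q) * ?w (c p) (c q)) = (\<Sum>j<n. ?w (c p) j)" for p
      by (rule sum_over_bases)
    then show ?thesis
      using sum_over_bases[of "\<lambda>i. \<Sum>j<n. ?w i j"] by (simp only:)
  qed
  finally have "Determinant.det (base_extension (\<lambda>i j. ?z i j + 1)) =
      Determinant.det (base_extension ?z) * (1 + (\<Sum>i<n. \<Sum>j<n. ?w i j))" .
  then show ?ratio unfolding L L' by (simp add: det_mult[of _ N])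
  show ?nonzero unfolding L using nz by (simp add: det_mult[of _ N])
qed

text \<open>Differencing preserves both determinants and row scaling multiplies both by the same
  power of \<open>inverse r\<close>, so the ratio can be computed from the scaled matrices, whose
  limit is invertible.\<close>

lemma perturbed_zeta_limit:
  assumes "Determinant.det (first_order_mat R) \<noteq> 0"
  shows "\<forall>\<^sub>F r in at_right 0. Determinant.det (Matrix.mat N N (\<lambda>(p, q). perturbed_zeta R r p q)) \<noteq> 0"
    and "((\<lambda>r. Determinant.det (Matrix.mat N N (\<lambda>(p, q). perturbed_zeta R r p q + 1)) /
      Determinant.det (Matrix.mat N N (\<lambda>(p, q). perturbed_zeta R r p q)) - 1) \<longlongrightarrow>
      (\<Sum>i<n. \<Sum>j<n. W $$ (i, j))) (at_right 0)"
proof -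
  let ?T = "\<lambda>r. Determinant.det (Matrix.mat N N (\<lambda>(p, q). scaled_diff R r p q))"
  let ?T' = "\<lambda>r. Determinant.det (Matrix.mat N N (\<lambda>(p, q). scaled_diff R r p q + of_bool (\<not> nonbase p) * of_bool (\<not> nonbase q)))"
  let ?L = "Determinant.det (Matrix.mat N N (\<lambda>(p, q). limit_mat R p q))"
  let ?L' = "Determinant.det (Matrix.mat N N (\<lambda>(p, q). limit_mat R p q + of_bool (\<not> nonbase p) * of_bool (\<not> nonbase q)))"
  let ?Z = "\<lambda>r. Determinant.det (Matrix.mat N N (\<lambda>(p, q). perturbed_zeta R r p q))"
  let ?Z' = "\<lambda>r. Determinant.det (Matrix.mat N N (\<lambda>(p, q). perturbed_zeta R r p q + 1))"
  let ?s = "\<lambda>r. \<Prod>p<N. if nonbase p then inverse r else (1 :: real)"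
  have T: "?T r = ?s r * ?Z r" for r
    unfolding scaled_diff_def det_scale_rows det_diff ..
  have T': "?T' r = ?s r * ?Z' r" for r
  proof -
    \<comment> \<open>Differencing the all-ones matrix leaves ones on the base block only, where the
      row factor is 1.\<close>
    have "scaled_diff R r p q + of_bool (\<not> nonbase p) * of_bool (\<not> nonbase q) =
        (if nonbase p then inverse r else 1) * diff (\<lambda>p q. perturbed_zeta R r p q + 1) p q" for p q
      by (simp add: scaled_diff_def diff_def col_diff_def)
    then show ?thesis
      by (simp only: det_scale_rows det_diff)
  qed
  have lim: "(?T \<longlongrightarrow> ?L) (at_right 0)" "(?T' \<longlongrightarrow> ?L') (at_right 0)"
    by (intro tendsto_det tendsto_add tendsto_const tendsto_scaled_diff)+
  have nz: "?L \<noteq> 0" using assms det_limit_mat(1) by simp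
  have "\<forall>\<^sub>F r in at_right 0. ?T r \<noteq> 0"
    using tendsto_imp_eventually_ne[OF lim(1) nz] .
  then show "\<forall>\<^sub>F r in at_right 0. ?Z r \<noteq> 0"
    by (rule eventually_mono) (simp add: T)
  have "((\<lambda>r. ?T' r / ?T r - 1) \<longlongrightarrow> ?L' / ?L - 1) (at_right 0)"
    by (intro tendsto_intros lim nz)
  moreover have "?L' / ?L - 1 = (\<Sum>i<n. \<Sum>j<n. W $$ (i, j))"
    using nz by (simp add: det_limit_mat(2))
  moreover have "\<forall>\<^sub>F r in at_right 0. ?T' r / ?T r - 1 = ?Z' r / ?Z r - 1"
    using eventually_at_right_less[of 0]
  proof (rule eventually_mono)
    fix r :: real assume "0 < r"
    then have "?s r \<noteq> 0" by auto
    then show "?T' r / ?T r - 1 = ?Z' r / ?Z r - 1" by (simp add: T T')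
  qed
  ultimately show "((\<lambda>r. ?Z' r / ?Z r - 1) \<longlongrightarrow> (\<Sum>i<n. \<Sum>j<n. W $$ (i, j))) (at_right 0)"
    using tendsto_cong by fastforce
qed

end

subsection \<open>Coordinates on symmetric matrices\<close>

text \<open>Inverse of \<open>Sym0_coords N\<close> on functions that are \<open>undefined\<close>
  outside \<open>upper_indices N\<close>.\<close>

definition coords_mat :: "nat \<Rightarrow> (nat \<times> nat \<Rightarrow> real) \<Rightarrow> real mat" where
  "coords_mat N y = Matrix.mat N N (\<lambda>(i, j). if i < j then y (i, j) else if j < i then y (j, i) else 0)"

abbreviation coords_lborel :: "nat \<Rightarrow> (nat \<times> nat \<Rightarrow> real) measure" where
  "coords_lborel N \<equiv> lborel_PiM (upper_indices N)"

lemma finite_upper_indices [simp]: "finite (upper_indices N)"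
  by (rule finite_subset[of _ "{..<N} \<times> {..<N}"]) (auto simp: upper_indices_def)

lemma coords_mat_carrier [simp]: "coords_mat N y \<in> carrier_mat N N"
  by (simp add: coords_mat_def)

lemma coords_mat_in_Sym0 [simp]: "coords_mat N y \<in> Sym0 N"
  by (auto simp: Sym0_def coords_mat_def)

lemma coords_mat_upper: "e \<in> upper_indices N \<Longrightarrow> coords_mat N y $$ e = y e"
  by (auto simp: upper_indices_def coords_mat_def)

lemma coords_mat_Sym0_coords: "D \<in> Sym0 N \<Longrightarrow> coords_mat N (Sym0_coords N D) = D"
  by (rule eq_matI) (auto simp: Sym0_def coords_mat_def Sym0_coords_def upper_indices_def)

lemma Sym0_coords_coords_mat:
  "y \<in> space (coords_lborel N) \<Longrightarrow> Sym0_coords N (coords_mat N y) = y"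
  by (rule ext) (auto simp: Sym0_coords_def coords_mat_upper space_PiM PiE_iff extensional_def restrict_def)

text \<open>Volume and measurability are stated through images under the coordinate map; this turns
  them into preimages under \<open>coords_mat N\<close>.\<close>

lemma Sym0_coords_image:
  "Sym0_coords N ` {D \<in> Sym0 N. Q D} = {y \<in> space (coords_lborel N). Q (coords_mat N y)}"
proof (intro equalityI subsetI)
  fix y assume "y \<in> {y \<in> space (coords_lborel N). Q (coords_mat N y)}"
  then show "y \<in> Sym0_coords N ` {D \<in> Sym0 N. Q D}"
    by (intro image_eqI[of _ _ "coords_mat N y"]) (auto simp: Sym0_coords_coords_mat)
next
  fix y assume "y \<in> Sym0_coords N ` {D \<in> Sym0 N. Q D}"
  then obtain D where D: "D \<in> Sym0 N" "Q D" and y: "y = Sym0_coords N D" by auto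
  have "y \<in> space (coords_lborel N)"
    unfolding y Sym0_coords_def by (simp add: space_PiM)
  moreover have "Q (coords_mat N y)" using D by (simp add: y coords_mat_Sym0_coords)
  ultimately show "y \<in> {y \<in> space (coords_lborel N). Q (coords_mat N y)}" by simp
qed

lemma coords_mat_affine:
  assumes "p < N" "q < N" "P \<in> Sym0 N"
  shows "coords_mat N (\<lambda>e\<in>upper_indices N. P $$ e + r * y e) $$ (p, q) = P $$ (p, q) + r * coords_mat N y $$ (p, q)"
  using assms by (auto simp: coords_mat_def upper_indices_def Sym0_def)

lemma measurable_coords_mat_entry:
  assumes "p < N" "q < N"
  shows "(\<lambda>y. coords_mat N y $$ (p, q)) \<in> borel_measurable (coords_lborel N)"
proof -
  have "(\<lambda>y. y e) \<in> borel_measurable (coords_lborel N)" if "e \<in> upper_indices N" for e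
    using measurable_component_singleton[OF that, of "\<lambda>_. lborel"] by simp
  with assms show ?thesis
    by (cases p q rule: linorder_cases) (auto simp: coords_mat_def upper_indices_def)
qed

lemma measurable_exp_coords_mat_entry:
  assumes "p < N" "q < N"
  shows "(\<lambda>y. exp (- coords_mat N y $$ (p, q))) \<in> borel_measurable (coords_lborel N)"
  using measurable_compose[OF borel_measurable_uminus[OF measurable_coords_mat_entry[OF assms]],
      of exp borel] by simp

lemma Sym0_measurableI:
  assumes "{y \<in> space (coords_lborel N). Q (coords_mat N y)} \<in> sets (coords_lborel N)"
  shows "Sym0_measurable N {D \<in> Sym0 N. Q D}"
  using assms by (auto simp: Sym0_measurable_def Sym0_coords_image coords_lebesgue_def intro: sets_completionI_sets)

text \<open>The dilation \<open>P + r * y\<close> maps the unit ball onto the ball of radius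
  \<open>r\<close>. All small balls are thus compared on one fixed domain, with a common power of
  \<open>r\<close> in front.\<close>

lemma Sym0_vol_Int_ball:
  assumes Q: "{y \<in> space (coords_lborel N). Q (coords_mat N y)} \<in> sets (coords_lborel N)"
    and P: "P \<in> Sym0 N" and r: "r > 0"
  shows "Sym0_vol N ({D \<in> Sym0 N. Q D} \<inter> Sym0_ball N P r) =
    r ^ card (upper_indices N) * measure (coords_lborel N)
      {y \<in> space (coords_lborel N). Q (coords_mat N (\<lambda>e\<in>upper_indices N. P $$ e + r * y e)) \<and>
        L2_set y (upper_indices N) < 1}"
proof -
  let ?I = "upper_indices N" and ?M = "coords_lborel N"
  define A where "A = {y \<in> space ?M. Q (coords_mat N y) \<and> L2_set (\<lambda>e. y e - P $$ e) ?I < r}"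
  have A: "A \<in> sets ?M"
  proof -
    have "(\<lambda>y. L2_set (\<lambda>e. y e - P $$ e) ?I) \<in> borel_measurable ?M"
      unfolding L2_set_def by measurable
    then have "{y \<in> space ?M. L2_set (\<lambda>e. y e - P $$ e) ?I < r} \<in> sets ?M"
      by measurable
    moreover have "A = {y \<in> space ?M. Q (coords_mat N y)} \<inter> {y \<in> space ?M. L2_set (\<lambda>e. y e - P $$ e) ?I < r}"
      by (auto simp: A_def)
    ultimately show ?thesis using Q by auto
  qed
  have L2: "L2_set (\<lambda>e. coords_mat N y $$ e - P $$ e) ?I = L2_set (\<lambda>e. y e - P $$ e) ?I" for y
    by (rule L2_set_cong) (auto simp: coords_mat_upper)
  have "{D \<in> Sym0 N. Q D} \<inter> Sym0_ball N P r = {D \<in> Sym0 N. Q D \<and> L2_set (\<lambda>e. D $$ e - P $$ e) ?I < r}"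
    by (auto simp: Sym0_ball_def)
  then have "Sym0_coords N ` ({D \<in> Sym0 N. Q D} \<inter> Sym0_ball N P r) = A"
    by (simp add: Sym0_coords_image A_def L2)
  \<comment> \<open>\<open>A\<close> lies in the uncompleted product sigma-algebra, where the
    completion has the same measure.\<close>
  then have "Sym0_vol N ({D \<in> Sym0 N. Q D} \<inter> Sym0_ball N P r) = measure ?M A"
    using A by (simp add: Sym0_vol_def coords_lebesgue_def measure_def)
  also have "\<dots> = r ^ card ?I * measure ?M {y \<in> space ?M. (\<lambda>e\<in>?I. P $$ e + r * y e) \<in> A}"
    using lborel_PiM_affine_preimage[OF finite_upper_indices r A, of "\<lambda>e. P $$ e"] r
    by (simp add: measure_def enn2real_mult)
  also have "{y \<in> space ?M. (\<lambda>e\<in>?I. P $$ e + r * y e) \<in> A} =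
      {y \<in> space ?M. Q (coords_mat N (\<lambda>e\<in>?I. P $$ e + r * y e)) \<and> L2_set y ?I < 1}"
  proof -
    have "L2_set (\<lambda>e. (\<lambda>e\<in>?I. P $$ e + r * y e) e - P $$ e) ?I = r * L2_set y ?I" for y
      using r by (subst L2_set_right_distrib) (auto intro!: L2_set_cong)
    then show ?thesis using r by (auto simp: A_def space_PiM)
  qed
  finally show ?thesis .
qed

lemma measurable_distance_matrices:
  "{y \<in> space (coords_lborel N). coords_mat N y \<in> distance_matrices N} \<in> sets (coords_lborel N)"
proof -
  note entry = measurable_coords_mat_entry
  have pos: "Measurable.pred (coords_lborel N) (\<lambda>y. 0 < coords_mat N y $$ (i, j))"
    if "i < N" "j < N" for i j
    by (intro borel_measurable_pred_less borel_measurable_const entry that)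
  have tri: "Measurable.pred (coords_lborel N)
      (\<lambda>y. coords_mat N y $$ (i, k) \<le> coords_mat N y $$ (i, j) + coords_mat N y $$ (j, k))"
    if "i < N" "j < N" "k < N" for i j k
    unfolding pred_def by (intro borel_measurable_le borel_measurable_add entry that)
  have "Measurable.pred (coords_lborel N) (\<lambda>y. \<forall>i<N. \<forall>j<N. i \<noteq> j \<longrightarrow> 0 < coords_mat N y $$ (i, j))"
    by (rule pred_intros_countable(1), rule pred_intros_imp', rule pred_intros_countable(1),
        rule pred_intros_imp', rule pred_intros_imp', rule pos)
  moreover have "Measurable.pred (coords_lborel N) (\<lambda>y. \<forall>i<N. \<forall>j<N. \<forall>k<N. i \<noteq> j \<and> j \<noteq> k \<and> i \<noteq> k \<longrightarrow>
        coords_mat N y $$ (i, k) \<le> coords_mat N y $$ (i, j) + coords_mat N y $$ (j, k))"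
    by (rule pred_intros_countable(1), rule pred_intros_imp', rule pred_intros_countable(1),
        rule pred_intros_imp', rule pred_intros_countable(1), rule pred_intros_imp',
        rule pred_intros_imp', rule tri)
  ultimately have "Measurable.pred (coords_lborel N) (\<lambda>y. (\<forall>i<N. \<forall>j<N. i \<noteq> j \<longrightarrow> 0 < coords_mat N y $$ (i, j)) \<and>
      (\<forall>i<N. \<forall>j<N. \<forall>k<N. i \<noteq> j \<and> j \<noteq> k \<and> i \<noteq> k \<longrightarrow>
        coords_mat N y $$ (i, k) \<le> coords_mat N y $$ (i, j) + coords_mat N y $$ (j, k)))"
    by (rule pred_intros_logic(3))
  then show ?thesis by (simp only: pred_def distance_matrices_def mem_Collect_eq coords_mat_in_Sym0 simp_thms)
qed

section \<open>Measurability of the magnitude and of its domain\<close>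

lemma det_zeta_coords_mat:
  "Determinant.det (zeta_matrix (coords_mat N y)) =
    Determinant.det (Matrix.mat N N (\<lambda>(i, j). exp (- coords_mat N y $$ (i, j))))"
  by (rule arg_cong[of _ _ Determinant.det], rule eq_matI) (auto simp: zeta_matrix_def coords_mat_def)

text \<open>On lines in the all-ones direction, the determinant is a polynomial in \<open>exp (- t)\<close> with value 1 at 0.\<close>

lemma singular_zeta_null:
  "{y \<in> space (coords_lborel N). Determinant.det (zeta_matrix (coords_mat N y)) = 0} \<in> null_sets (coords_lborel N)"
proof (rule null_sets_lborel_PiM_if_countable_on_lines[where v = "\<lambda>_. 1"])
  show "finite (upper_indices N)" by simp
  have [measurable]: "(\<lambda>y. Determinant.det (zeta_matrix (coords_mat N y))) \<in> borel_measurable (coords_lborel N)"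
    unfolding det_zeta_coords_mat
    by (intro borel_measurable_det measurable_exp_coords_mat_entry)
  show "{y \<in> space (coords_lborel N). Determinant.det (zeta_matrix (coords_mat N y)) = 0} \<in> sets (coords_lborel N)"
    by measurable
  fix y assume "y \<in> space (coords_lborel N)"
  define A where "A = Matrix.mat N N (\<lambda>(i, j). if i = j then 0 else exp (- coords_mat N y $$ (i, j)))"
  have fin: "finite {u. Determinant.det (Matrix.mat N N (\<lambda>(i, j). 1\<^sub>m N $$ (i, j) + u * A $$ (i, j))) = 0}"
    by (rule finite_det_zeros) (auto simp: A_def)
  have "zeta_matrix (coords_mat N (\<lambda>e\<in>upper_indices N. y e + t * 1)) =
      Matrix.mat N N (\<lambda>(i, j). 1\<^sub>m N $$ (i, j) + exp (- t) * A $$ (i, j))" for t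
    by (rule eq_matI) (auto simp: zeta_matrix_def coords_mat_def A_def upper_indices_def exp_add[symmetric] algebra_simps)
  then have "{t. (\<lambda>e\<in>upper_indices N. y e + t * 1) \<in>
      {y \<in> space (coords_lborel N). Determinant.det (zeta_matrix (coords_mat N y)) = 0}} \<subseteq>
    (\<lambda>t. exp (- t)) -` {u. Determinant.det (Matrix.mat N N (\<lambda>(i, j). 1\<^sub>m N $$ (i, j) + u * A $$ (i, j))) = 0}"
    by auto
  moreover have "finite \<dots>"
    by (rule finite_vimageI[OF fin]) (auto intro: injI)
  ultimately show "countable {t. (\<lambda>e\<in>upper_indices N. y e + t * 1) \<in>
      {y \<in> space (coords_lborel N). Determinant.det (zeta_matrix (coords_mat N y)) = 0}}"
    by (meson countable_finite finite_subset)
qed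

text \<open>Where the magnitude is undefined the zeta determinant vanishes, and every subset of a
  null set is null for the completed measure.\<close>

lemma Sym0_null_magnitude_undefined:
  "Sym0_null N {D \<in> distance_matrices N \<inter> Sym0_ball N P r. magnitude D = None}"
proof -
  let ?E = "{D \<in> distance_matrices N \<inter> Sym0_ball N P r. magnitude D = None}"
  have "?E \<subseteq> {D \<in> Sym0 N. Determinant.det (zeta_matrix D) = 0}"
    by (auto simp: distance_matrices_def Sym0_def magnitude_eq_None_iff)
  then have "Sym0_coords N ` ?E \<subseteq> {y \<in> space (coords_lborel N). Determinant.det (zeta_matrix (coords_mat N y)) = 0}"
    unfolding Sym0_coords_image[of N "\<lambda>D. Determinant.det (zeta_matrix D) = 0", symmetric]
    by (rule image_mono)
  then have "Sym0_coords N ` ?E \<in> null_sets (coords_lebesgue N)"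
    unfolding coords_lebesgue_def
    by (rule null_sets_completion_subset) (rule null_sets_completionI[OF singular_zeta_null])
  then show ?thesis by (auto simp: Sym0_null_def distance_matrices_def)
qed

text \<open>The ratio formula expresses the condition through two measurable determinants.\<close>

lemma measurable_magnitude_near:
  fixes m \<epsilon> :: real
  shows "{y \<in> space (coords_lborel N). \<exists>z. magnitude (coords_mat N y) = Some z \<and> dist z m < \<epsilon>} \<in> sets (coords_lborel N)"
proof -
  let ?M = "coords_lborel N"
  let ?Z = "\<lambda>y. Determinant.det (Matrix.mat N N (\<lambda>(i, j). exp (- coords_mat N y $$ (i, j))))"
  let ?Z' = "\<lambda>y. Determinant.det (Matrix.mat N N (\<lambda>(i, j). exp (- coords_mat N y $$ (i, j)) + 1))"
  have [measurable]: "?Z \<in> borel_measurable ?M" "?Z' \<in> borel_measurable ?M"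
    by (intro borel_measurable_det borel_measurable_add borel_measurable_const
        measurable_exp_coords_mat_entry; assumption)+
  have "(\<exists>z. magnitude (coords_mat N y) = Some z \<and> dist z m < \<epsilon>) \<longleftrightarrow>
      ?Z y \<noteq> 0 \<and> dist (?Z' y / ?Z y - 1) m < \<epsilon>" for y
  proof (cases "?Z y = 0")
    case True
    then have "magnitude (coords_mat N y) = None"
      by (simp add: magnitude_eq_None_iff[of _ N] det_zeta_coords_mat)
    with True show ?thesis by simp
  next
    case False
    with magnitude_eq_det_ratio[of "coords_mat N y" N] show ?thesis
      by (simp add: det_zeta_coords_mat)
  qed
  moreover have "{y \<in> space ?M. ?Z y \<noteq> 0 \<and> dist (?Z' y / ?Z y - 1) m < \<epsilon>} \<in> sets ?M"
    by measurable
  ultimately show ?thesis by simp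
qed

lemma abs_le_L2_set: "finite I \<Longrightarrow> e \<in> I \<Longrightarrow> \<bar>y e\<bar> \<le> L2_set y I"
  using member_le_L2_set[of I e "\<lambda>e. \<bar>y e\<bar>"] by (simp add: L2_set_def)

lemma emeasure_unit_ball_finite:
  assumes "finite I"
  shows "emeasure (lborel_PiM I) {y \<in> space (lborel_PiM I). L2_set y I < 1} < \<infinity>"
proof -
  have "emeasure (lborel_PiM I) {y \<in> space (lborel_PiM I). L2_set y I < 1} \<le>
      emeasure (lborel_PiM I) (Pi\<^sub>E I (\<lambda>_. {-1..1}))"
  proof (rule emeasure_mono)
    show "{y \<in> space (lborel_PiM I). L2_set y I < 1} \<subseteq> Pi\<^sub>E I (\<lambda>_. {-1..1})"
    proof
      fix y assume y: "y \<in> {y \<in> space (lborel_PiM I). L2_set y I < 1}"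
      have "y e \<in> {-1..1}" if "e \<in> I" for e
        using abs_le_L2_set[OF assms that, of y] y by auto
      with y show "y \<in> Pi\<^sub>E I (\<lambda>_. {-1..1})" by (simp add: space_PiM PiE_iff)
    qed
    show "Pi\<^sub>E I (\<lambda>_. {-1..1}) \<in> sets (lborel_PiM I)"
      using assms by (intro sets_PiM_I_finite) auto
  qed
  also have "\<dots> = (\<Prod>e\<in>I. emeasure lborel {-1..1 :: real})"
    using assms by (intro lborel_product.emeasure_PiM) auto
  also have "\<dots> = ennreal (2 ^ card I)"
    by (simp flip: ennreal_power)
  also have "\<dots> < \<infinity>" by simp
  finally show ?thesis .
qed

subsection \<open>Relative density\<close>

locale stratum = clustered_zeta +
  assumes dist_nonneg: "i < n \<Longrightarrow> j < n \<Longrightarrow> 0 \<le> \<delta> i j"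
    and dist_sym: "i < n \<Longrightarrow> j < n \<Longrightarrow> \<delta> i j = \<delta> j i"
    and dist_triangle: "i < n \<Longrightarrow> j < n \<Longrightarrow> k < n \<Longrightarrow> \<delta> i k \<le> \<delta> i j + \<delta> j k"
begin

text \<open>The blow-up of the distance matrix of \<open>X\<close>, written through the cluster
  map.\<close>

definition center :: "real mat" where
  "center = Matrix.mat N N (\<lambda>(p, q). \<delta> (c p) (c q))"

definition mag :: real where
  "mag = (\<Sum>i<n. \<Sum>j<n. W $$ (i, j))"

abbreviation I :: "(nat \<times> nat) set" where
  "I \<equiv> upper_indices N"

abbreviation M :: "(nat \<times> nat \<Rightarrow> real) measure" where
  "M \<equiv> coords_lborel N"

abbreviation dilate :: "real \<Rightarrow> (nat \<times> nat \<Rightarrow> real) \<Rightarrow> real mat" where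
  "dilate r y \<equiv> coords_mat N (\<lambda>e\<in>I. center $$ e + r * y e)"

abbreviation entries :: "(nat \<times> nat \<Rightarrow> real) \<Rightarrow> nat \<Rightarrow> nat \<Rightarrow> real" where
  "entries y p q \<equiv> coords_mat N y $$ (p, q)"

definition near :: "real \<Rightarrow> real mat \<Rightarrow> bool" where
  "near \<epsilon> D \<longleftrightarrow> (\<exists>z. magnitude D = Some z \<and> dist z mag < \<epsilon>)"

lemma center_Sym0: "center \<in> Sym0 N"
  by (auto simp: center_def Sym0_def dist_zero cluster_less intro: dist_sym)

lemma dilate_entry:
  "p < N \<Longrightarrow> q < N \<Longrightarrow> dilate r y $$ (p, q) = \<delta> (c p) (c q) + r * entries y p q"
  using coords_mat_affine[OF _ _ center_Sym0, of p q r y] by (simp add: center_def)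

text \<open>Convergence along a single ray. How small \<open>r\<close> has to be depends on
  \<open>y\<close>; dominated convergence later replaces uniformity.\<close>

lemma eventually_near:
  assumes "Determinant.det (first_order_mat (entries y)) \<noteq> 0" and "\<epsilon> > 0"
  shows "\<forall>\<^sub>F r in at_right 0. near \<epsilon> (dilate r y)"
proof -
  let ?Z = "\<lambda>r. Determinant.det (Matrix.mat N N (\<lambda>(p, q). perturbed_zeta (entries y) r p q))"
  let ?Z' = "\<lambda>r. Determinant.det (Matrix.mat N N (\<lambda>(p, q). perturbed_zeta (entries y) r p q + 1))"
  have Z: "Determinant.det (Matrix.mat N N (\<lambda>(p, q). exp (- dilate r y $$ (p, q)))) = ?Z r" for r
    by (rule arg_cong[of _ _ Determinant.det], rule eq_matI) (simp_all add: dilate_entry perturbed_zeta_def)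
  have Z': "Determinant.det (Matrix.mat N N (\<lambda>(p, q). exp (- dilate r y $$ (p, q)) + 1)) = ?Z' r" for r
    by (rule arg_cong[of _ _ Determinant.det], rule eq_matI) (simp_all add: dilate_entry perturbed_zeta_def)
  have "\<forall>\<^sub>F r in at_right 0. dist (?Z' r / ?Z r - 1) mag < \<epsilon>"
    using tendstoD[OF perturbed_zeta_limit(2)[OF assms(1)] assms(2)] by (simp add: mag_def)
  with perturbed_zeta_limit(1)[OF assms(1)] show ?thesis
  proof eventually_elim
    case (elim r)
    have "magnitude (dilate r y) = Some (?Z' r / ?Z r - 1)"
      using magnitude_eq_det_ratio[of "dilate r y" N] elim(1)
      unfolding det_zeta_coords_mat Z Z' by simp
    with elim(2) show ?case by (simp add: near_def)
  qed
qed

text \<open>Every line in the direction \<open>star\<close> meets the singular set in finitely many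
  points, so the Fubini criterion applies.\<close>

lemma AE_nonsingular: "AE y in M. Determinant.det (first_order_mat (entries y)) \<noteq> 0"
proof -
  define v where "v e = star (fst e) (snd e)" for e
  define G where "G = {y \<in> space M. Determinant.det (first_order_mat (entries y)) = 0}"
  have "(\<lambda>y. Determinant.det (first_order_mat (entries y))) \<in> borel_measurable M"
    unfolding first_order_mat_def
  proof (rule borel_measurable_det)
    fix p q assume pq: "p < N" "q < N"
    have col_diff: "(\<lambda>y. col_diff (\<lambda>p q. exp (- \<delta> (c p) (c q)) * entries y p q) p q) \<in> borel_measurable M"
      if "p < N" for p
      unfolding col_diff_def
      by (intro borel_measurable_diff borel_measurable_times borel_measurable_const
          measurable_coords_mat_entry that base_less pq)
    show "(\<lambda>y. if nonbase p then first_order (entries y) p q else of_bool (p = q)) \<in> borel_measurable M"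
      unfolding first_order_def diff_def
      by (cases "nonbase p")
        (simp_all only: if_True if_False borel_measurable_const borel_measurable_uminus
          borel_measurable_diff borel_measurable_times col_diff pq base_less)
  qed
  then have "G \<in> sets M" unfolding G_def by measurable
  then have "G \<in> null_sets M"
  proof (rule null_sets_lborel_PiM_if_countable_on_lines[OF finite_upper_indices, where v = v])
    fix y assume "y \<in> space M"
    \<comment> \<open>\<open>star\<close> is symmetric with zero diagonal, so a line in the upper
      coordinates is the corresponding line of full matrices.\<close>
    have "first_order_mat (entries (\<lambda>e\<in>I. y e + t * v e)) =
        first_order_mat (\<lambda>p q. entries y p q + t * star p q)" for t
      by (rule first_order_mat_cong) (auto simp: coords_mat_def upper_indices_def v_def star_def)
    then have "{t. (\<lambda>e\<in>I. y e + t * v e) \<in> G} \<subseteq>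
        {t. Determinant.det (first_order_mat (\<lambda>p q. entries y p q + t * star p q)) = 0}"
      by (auto simp: G_def)
    then show "countable {t. (\<lambda>e\<in>I. y e + t * v e) \<in> G}"
      using finite_singular_on_star_lines by (meson countable_finite finite_subset)
  qed
  then show ?thesis by (rule AE_I') (auto simp: G_def)
qed

section \<open>A fixed proportion of metrics in every small ball\<close>

definition mesh :: real where
  "mesh = 1 / (2 * (1 + real (card I)))"

text \<open>The Euclidean norm is at most the sum of the \<open>card I\<close> absolute coordinates,
  each at most \<open>2 * mesh\<close> on the cube; the summand 1 in the denominator of
  \<open>mesh\<close> covers \<open>N \<le> 1\<close>, where there are no coordinates.\<close>

lemma mesh_pos: "mesh > 0" and card_mesh_less: "real (card I) * (2 * mesh) < 1"
  by (simp_all add: mesh_def field_simps)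

text \<open>A perturbation with all coordinates between \<open>mesh\<close> and \<open>2 * mesh\<close> turns any pseudometric into a metric.\<close>

definition cube :: "(nat \<times> nat \<Rightarrow> real) set" where
  "cube = Pi\<^sub>E I (\<lambda>_. {mesh <..< 2 * mesh})"

lemma cube_sets: "cube \<in> sets M"
  unfolding cube_def by (intro sets_PiM_I_finite) auto

lemma cube_measure_pos: "measure M cube > 0"
proof -
  have "emeasure M cube = (\<Prod>e\<in>I. emeasure lborel {mesh <..< 2 * mesh})"
    unfolding cube_def by (intro lborel_product.emeasure_PiM) auto
  also have "\<dots> = ennreal (mesh ^ card I)"
    using mesh_pos by (simp add: ennreal_power)
  finally show ?thesis using mesh_pos by (simp add: measure_def)
qed

lemma cube_subset_unit_ball:
  assumes y: "y \<in> cube"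
  shows "L2_set y I < 1"
proof -
  have "L2_set y I \<le> (\<Sum>e\<in>I. \<bar>y e\<bar>)" by (rule L2_set_le_sum_abs)
  also have "\<dots> \<le> (\<Sum>e\<in>I. 2 * mesh)"
  proof (rule sum_mono)
    fix e assume "e \<in> I"
    with y have "mesh < y e" "y e < 2 * mesh"
      by (auto simp: cube_def PiE_iff)
    then show "\<bar>y e\<bar> \<le> 2 * mesh" using mesh_pos by linarith
  qed
  also have "\<dots> < 1" using card_mesh_less by simp
  finally show ?thesis .
qed

text \<open>Every added term lies between \<open>r * mesh\<close> and \<open>2 * r * mesh\<close>,
  so each is at most the sum of two others and the triangle inequalities of \<open>\<delta>\<close>
  survive. Distances inside a cluster, where \<open>\<delta>\<close> is 0, become positive.\<close>

lemma dilate_cube: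
  assumes y: "y \<in> cube" and r: "r > 0"
  shows "dilate r y \<in> distance_matrices N"
proof -
  have bounds: "mesh < entries y p q" "entries y p q < 2 * mesh" if "p < N" "q < N" "p \<noteq> q" for p q
    using y that unfolding cube_def
    by (cases "p < q"; force simp: coords_mat_def upper_indices_def PiE_iff)+
  show ?thesis
    unfolding distance_matrices_def mem_Collect_eq
  proof (intro conjI allI impI)
    fix p q assume pq: "p < N" "q < N" "p \<noteq> q"
    have "0 < r * entries y p q" using bounds[OF pq] mesh_pos r by simp
    then show "0 < dilate r y $$ (p, q)"
      using dist_nonneg[of "c p" "c q"] pq by (simp add: dilate_entry cluster_less)
  next
    fix p q k assume pqk: "p < N" "q < N" "k < N" "p \<noteq> q \<and> q \<noteq> k \<and> p \<noteq> k"
    have "entries y p k \<le> entries y p q + entries y q k"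
      using bounds[of p k] bounds[of p q] bounds[of q k] pqk by linarith
    then have "r * entries y p k \<le> r * entries y p q + r * entries y q k"
      using r by (simp flip: distrib_left)
    then show "dilate r y $$ (p, k) \<le> dilate r y $$ (p, q) + dilate r y $$ (q, k)"
      using dist_triangle[of "c p" "c q" "c k"] pqk by (simp add: dilate_entry cluster_less)
  qed simp
qed

section \<open>Bad directions and the density estimate\<close>

definition unit_ball :: "(nat \<times> nat \<Rightarrow> real) set" where
  "unit_ball = {y \<in> space M. L2_set y I < 1}"

lemma unit_ball_sets: "unit_ball \<in> sets M"
proof -
  have "(\<lambda>y. L2_set y I) \<in> borel_measurable M"
    unfolding L2_set_def by measurable
  then show ?thesis unfolding unit_ball_def by measurable
qed

lemma unit_ball_finite: "emeasure M unit_ball < \<infinity>"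
  unfolding unit_ball_def by (rule emeasure_unit_ball_finite) simp

lemma dilate_preimage_sets:
  assumes "{y \<in> space M. Q (coords_mat N y)} \<in> sets M"
  shows "{y \<in> space M. Q (dilate r y)} \<in> sets M"
proof -
  have f: "(\<lambda>y. \<lambda>e\<in>I. center $$ e + r * y e) \<in> measurable M M"
    by measurable
  have "(\<lambda>y. \<lambda>e\<in>I. center $$ e + r * y e) -` {y \<in> space M. Q (coords_mat N y)} \<inter> space M \<in> sets M"
    by (rule measurable_sets[OF f assms])
  also have "(\<lambda>y. \<lambda>e\<in>I. center $$ e + r * y e) -` {y \<in> space M. Q (coords_mat N y)} \<inter> space M =
      {y \<in> space M. Q (dilate r y)}"
    by (auto simp: space_PiM)
  finally show ?thesis .
qed

lemma near_sets: "{y \<in> space M. near \<epsilon> (coords_mat N y)} \<in> sets M"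
  unfolding near_def by (rule measurable_magnitude_near)

text \<open>Directions in which the magnitude is undefined count as bad.\<close>

definition bad :: "real \<Rightarrow> real \<Rightarrow> (nat \<times> nat \<Rightarrow> real) set" where
  "bad \<epsilon> r = {y \<in> unit_ball. \<not> near \<epsilon> (dilate r y)}"

lemma bad_sets: "bad \<epsilon> r \<in> sets M"
proof -
  have "bad \<epsilon> r = unit_ball - {y \<in> space M. near \<epsilon> (dilate r y)}"
    by (auto simp: bad_def unit_ball_def)
  with unit_ball_sets dilate_preimage_sets[OF near_sets] show ?thesis by auto
qed

text \<open>Dominated convergence: the indicators tend to 0 for almost every direction and are
  bounded by the indicator of the unit ball, which has finite volume.\<close>

lemma tendsto_measure_bad:
  assumes "\<epsilon> > 0"
  shows "((\<lambda>r. measure M (bad \<epsilon> r)) \<longlongrightarrow> 0) (at_right 0)"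
proof -
  \<comment> \<open>The substitution \<open>r = inverse t\<close> moves the limit from
    \<open>at_right 0\<close> to \<open>at_top\<close>.\<close>
  have "((\<lambda>t. \<integral>y. indicator (bad \<epsilon> (inverse t)) y \<partial>M) \<longlongrightarrow> (\<integral>y. (0 :: real) \<partial>M)) at_top"
  proof (rule integral_dominated_convergence_at_top[where w = "indicator unit_ball"])
    show "(\<lambda>y. indicator (bad \<epsilon> (inverse t)) y :: real) \<in> borel_measurable M" for t
      by (rule borel_measurable_indicator) (rule bad_sets)
    show "integrable M (indicator unit_ball :: _ \<Rightarrow> real)"
      using unit_ball_sets unit_ball_finite by (simp add: integrable_indicator_iff)
    show "AE y in M. ((\<lambda>t. indicator (bad \<epsilon> (inverse t)) y :: real) \<longlongrightarrow> 0) at_top"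
      using AE_nonsingular
    proof eventually_elim
      case (elim y)
      from eventually_near[OF elim assms]
      have "\<forall>\<^sub>F t in at_top. near \<epsilon> (dilate (inverse t) y)"
        by (simp add: eventually_at_right_to_top)
      then have "\<forall>\<^sub>F t in at_top. (indicator (bad \<epsilon> (inverse t)) y :: real) = 0"
        by (rule eventually_mono) (simp add: bad_def)
      then show ?case by (rule tendsto_eventually)
    qed
    show "\<forall>\<^sub>F t in at_top. AE y in M. norm (indicator (bad \<epsilon> (inverse t)) y :: real) \<le> indicator unit_ball y"
      by (intro always_eventually allI AE_I2) (auto simp: bad_def indicator_def)
  qed simp
  moreover have "(\<integral>y. indicator (bad \<epsilon> r) y \<partial>M) = measure M (bad \<epsilon> r)" for r
    using bad_sets[of \<epsilon> r] sets.sets_into_space[OF bad_sets[of \<epsilon> r]] by (simp add: Int_absorb2)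
  ultimately show ?thesis by (simp add: filterlim_at_right_to_top)
qed

text \<open>After rescaling, numerator and denominator differ by at most the volume of the bad
  directions, while the denominator is at least the volume of \<open>cube\<close>, independently of
  \<open>r\<close>.\<close>

lemma relative_density_one_near:
  assumes \<epsilon>: "\<epsilon> > 0"
  shows "relative_density_one N center {D \<in> distance_matrices N. near \<epsilon> D}"
proof -
  let ?good = "\<lambda>D. D \<in> distance_matrices N \<and> near \<epsilon> D"
  have Sym0: "{D \<in> Sym0 N. D \<in> distance_matrices N} = distance_matrices N"
    "{D \<in> Sym0 N. ?good D} = {D \<in> distance_matrices N. near \<epsilon> D}"
    by (auto simp: distance_matrices_def)
  have good_sets: "{y \<in> space M. ?good (coords_mat N y)} \<in> sets M"
    using sets.sets_Collect_conj[OF near_sets measurable_distance_matrices] .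
  define a where "a r = measure M {y \<in> unit_ball. ?good (dilate r y)}" for r
  define b where "b r = measure M {y \<in> unit_ball. dilate r y \<in> distance_matrices N}" for r
  let ?k = "measure M cube"
  have ratio: "Sym0_vol N ({D \<in> distance_matrices N. near \<epsilon> D} \<inter> Sym0_ball N center r) /
      Sym0_vol N (distance_matrices N \<inter> Sym0_ball N center r) = a r / b r" if "r > 0" for r
  proof -
    have "Sym0_vol N ({D \<in> distance_matrices N. near \<epsilon> D} \<inter> Sym0_ball N center r) = r ^ card I * a r"
      using Sym0_vol_Int_ball[OF good_sets center_Sym0 that]
      unfolding Sym0 a_def unit_ball_def by (simp add: conj_ac)
    moreover have "Sym0_vol N (distance_matrices N \<inter> Sym0_ball N center r) = r ^ card I * b r"
      using Sym0_vol_Int_ball[OF measurable_distance_matrices center_Sym0 that]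
      unfolding Sym0 b_def unit_ball_def by (simp add: conj_ac)
    ultimately show ?thesis using that by simp
  qed
  have bound: "\<bar>a r / b r - 1\<bar> \<le> measure M (bad \<epsilon> r) / ?k" if "r > 0" for r
  proof -
    let ?A = "{y \<in> unit_ball. ?good (dilate r y)}"
    let ?B = "{y \<in> unit_ball. dilate r y \<in> distance_matrices N}"
    have "?A = unit_ball \<inter> {y \<in> space M. ?good (dilate r y)}"
      "?B = unit_ball \<inter> {y \<in> space M. dilate r y \<in> distance_matrices N}"
      by (auto simp: unit_ball_def)
    then have A: "?A \<in> sets M" and B: "?B \<in> sets M"
      using unit_ball_sets dilate_preimage_sets[OF good_sets, of r]
        dilate_preimage_sets[OF measurable_distance_matrices, of r] by auto
    \<comment> \<open>\<open>measure\<close> is 0 on sets of infinite volume, so its monotonicity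
      requires finite volume.\<close>
    have fm: "S \<in> fmeasurable M" if "S \<in> sets M" "S \<subseteq> unit_ball" for S
    proof (rule fmeasurableI2[OF _ that(2,1)])
      show "unit_ball \<in> fmeasurable M"
        using unit_ball_sets unit_ball_finite by (rule fmeasurableI)
    qed
    have fB: "?B \<in> fmeasurable M" by (rule fm[OF B]) auto
    have fAbad: "?A \<union> bad \<epsilon> r \<in> fmeasurable M"
      by (rule fm) (use A bad_sets in \<open>auto simp: bad_def\<close>)
    have "cube \<subseteq> ?B"
      using cube_subset_unit_ball dilate_cube[OF _ that] sets.sets_into_space[OF cube_sets]
      by (auto simp: unit_ball_def)
    then have k: "?k \<le> b r"
      unfolding b_def by (rule measure_mono_fmeasurable[OF _ cube_sets fB])
    have ab: "a r \<le> b r"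
      unfolding a_def b_def by (rule measure_mono_fmeasurable[OF _ A fB]) auto
    have ba: "b r \<le> a r + measure M (bad \<epsilon> r)"
    proof -
      have "?B \<subseteq> ?A \<union> bad \<epsilon> r" by (auto simp: bad_def)
      then have "b r \<le> measure M (?A \<union> bad \<epsilon> r)"
        unfolding b_def by (rule measure_mono_fmeasurable[OF _ B fAbad])
      also have "\<dots> \<le> measure M ?A + measure M (bad \<epsilon> r)"
        using A bad_sets by (rule measure_Un_le)
      finally show ?thesis by (simp add: a_def)
    qed
    have pos: "0 < b r" using k cube_measure_pos by simp
    then have "\<bar>a r / b r - 1\<bar> = (b r - a r) / b r"
      using ab by (simp add: diff_divide_distrib)
    also have "\<dots> \<le> measure M (bad \<epsilon> r) / b r"
      using ba pos by (intro divide_right_mono) auto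
    also have "\<dots> \<le> measure M (bad \<epsilon> r) / ?k"
      using k cube_measure_pos by (intro divide_left_mono mult_pos_pos) auto
    finally show ?thesis .
  qed
  have "((\<lambda>r. measure M (bad \<epsilon> r) / ?k) \<longlongrightarrow> 0) (at_right 0)"
    using tendsto_divide[OF tendsto_measure_bad[OF \<epsilon>] tendsto_const[of ?k]] cube_measure_pos by simp
  then have "((\<lambda>r. a r / b r - 1) \<longlongrightarrow> 0) (at_right 0)"
  proof (rule Lim_null_comparison[rotated])
    show "\<forall>\<^sub>F r in at_right 0. norm (a r / b r - 1) \<le> measure M (bad \<epsilon> r) / ?k"
      using eventually_at_right_less[of 0] by (rule eventually_mono) (simp add: bound)
  qed
  then have "((\<lambda>r. a r / b r) \<longlongrightarrow> 1) (at_right 0)"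
    by (simp add: LIM_zero_iff)
  then have "((\<lambda>r. Sym0_vol N ({D \<in> distance_matrices N. near \<epsilon> D} \<inter> Sym0_ball N center r) /
      Sym0_vol N (distance_matrices N \<inter> Sym0_ball N center r)) \<longlongrightarrow> 1) (at_right 0)"
  proof (rule Lim_transform_eventually)
    show "\<forall>\<^sub>F r in at_right 0. a r / b r = Sym0_vol N ({D \<in> distance_matrices N. near \<epsilon> D} \<inter> Sym0_ball N center r) /
        Sym0_vol N (distance_matrices N \<inter> Sym0_ball N center r)"
      using eventually_at_right_less[of 0] by (rule eventually_mono) (simp add: ratio)
  qed
  moreover have "Sym0_measurable N {D \<in> distance_matrices N. near \<epsilon> D}"
    using Sym0_measurableI[OF good_sets] unfolding Sym0 .
  ultimately show ?thesis by (auto simp: relative_density_one_def)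
qed

end


section \<open>The blockwise order as a clustering\<close>

lemma block_index_eqI:
  assumes "(\<Sum>k<i. s k) \<le> p" and "p < (\<Sum>k\<le>i. s k)"
  shows "block_index s p = i"
  unfolding block_index_def
proof (rule Least_equality)
  fix j assume j: "p < (\<Sum>k\<le>j. s k)"
  show "i \<le> j"
  proof (rule ccontr)
    assume "\<not> i \<le> j"
    then have "(\<Sum>k\<le>j. s k) \<le> (\<Sum>k<i. s k)" by (intro sum_mono2) auto
    with j assms(1) show False by simp
  qed
qed (rule assms(2))

lemma block_index_clustering:
  assumes "\<And>i. i < n \<Longrightarrow> s i > 0"
  shows "clustering (\<Sum>i<n. s i) n (block_index s)"
proof
  fix p assume p: "p < (\<Sum>i<n. s i)"
  \<comment> \<open>\<open>n\<close> is positive because the sum exceeds \<open>p\<close>;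
    \<open>block_index\<close> uses inclusive partial sums, so the full sum is the one up to
    \<open>m\<close>.\<close>
  then obtain m where m: "n = Suc m" by (cases n) auto
  with p have "p < (\<Sum>k\<le>m. s k)" by (simp add: lessThan_Suc_atMost)
  then have "block_index s p \<le> m" unfolding block_index_def by (rule Least_le)
  with m show "block_index s p < n" by simp
next
  fix i assume i: "i < n"
  \<comment> \<open>The first index of block \<open>i\<close>, which lies in that block because
    \<open>s i > 0\<close>.\<close>
  let ?p = "\<Sum>k<i. s k"
  have Suc: "(\<Sum>k\<le>i. s k) = ?p + s i" by (simp flip: lessThan_Suc_atMost)
  have "(\<Sum>k\<le>i. s k) \<le> (\<Sum>k<n. s k)" using i by (intro sum_mono2) auto
  moreover have "block_index s ?p = i"
    by (rule block_index_eqI) (use assms[OF i] Suc in auto)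
  ultimately show "\<exists>p<\<Sum>i<n. s i. block_index s p = i"
    using assms[OF i] Suc by (intro exI[of _ ?p]) auto
qed

theorem corollary4p5:
  fixes X :: "'a set" and d :: "'a \<Rightarrow> 'a \<Rightarrow> real"
    and n :: nat and x :: "nat \<Rightarrow> 'a" and s :: "nat \<Rightarrow> nat"
  assumes "Metric_space X d"
    and "n \<ge> 1"
    and "bij_betw x {..<n} X"
    and "invertible_mat (zeta_matrix (distance_matrix d x n))"
    and "\<And>i. i < n \<Longrightarrow> s i > 0"
  shows "stratified_approx_limit magnitude (the (magnitude (distance_matrix d x n)))
           (distance_matrix d x n) s"
proof -
  let ?D = "distance_matrix d x n" and ?N = "\<Sum>i<n. s i"
  interpret Metric_space X d by fact
  have x: "x i \<in> X" if "i < n" for i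
    using that assms(3) by (auto simp: bij_betw_def)
  have D: "?D \<in> carrier_mat n n" by (simp add: distance_matrix_def)
  have zeta: "zeta_matrix ?D = Matrix.mat n n (\<lambda>(i, j). exp (- d (x i) (x j)))"
    by (rule eq_matI) (auto simp: zeta_matrix_def distance_matrix_def)
  obtain W where mat_inv: "mat_inverse (zeta_matrix ?D) = Some W"
    using assms(4) invertible_mat_iff_mat_inverse[OF zeta_matrix_carrier[OF D]] by auto
  note inv = mat_inverse(2)[OF zeta_matrix_carrier[OF D] mat_inv]
  interpret clustering ?N n "block_index s"
    by (rule block_index_clustering) (rule assms(5))
  interpret stratum ?N n "block_index s" "\<lambda>i j. d (x i) (x j)" W
  proof
    show "Matrix.mat n n (\<lambda>(i, j). exp (- d (x i) (x j))) * W = 1\<^sub>m n" "W \<in> carrier_mat n n"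
      using inv by (simp_all add: zeta)
  qed (simp_all add: x commute triangle)
  have mag: "magnitude ?D = Some mag"
    using mat_inv inv by (auto simp: magnitude_def mag_def)
  have center: "blow_up ?D s = center"
    by (rule eq_matI)
      (auto simp: blow_up_def Let_def center_def distance_matrix_def cluster_less)
  have dim: "dim_row ?D = n" using D by simp
  show ?thesis
    unfolding stratified_approx_limit_def Let_def dim center mag option.sel
  proof (intro conjI allI impI)
    \<comment> \<open>The exceptional set is null in every ball, so any positive radius
      serves.\<close>
    show "\<exists>r>0. Sym0_null ?N {D \<in> distance_matrices ?N \<inter> Sym0_ball ?N center r. magnitude D = None}"
      using Sym0_null_magnitude_undefined by (intro exI[of _ 1]) auto
    fix \<epsilon> :: real assume "0 < \<epsilon>"
    then show "relative_density_one ?N center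
        {D \<in> distance_matrices ?N. \<exists>y. magnitude D = Some y \<and> dist y mag < \<epsilon>}"
      using relative_density_one_near unfolding near_def by blast
  qed
qed

end
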